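(* Let $d,n\ge1$ be integers, $\lambda_1,\dots,\lambda_n\ge0$ with $\sum_{i=1}^n\lambda_i=1$, and $\gamma>0$. Assume that $\mu_i=\mathcal{N}(0,A_i)$ is the Gaussian distribution with mean zero and covariance matrix $A_i\in\mathbb{S}(d,\mathbb{R})_+$ for $i=1,\dots,n$. Then the problem $$\min_{\mu\in\mathcal{P}_2(\mathbb{R}^d)}\ \sum_{i=1}^n\frac12\lambda_iW_2^2(\mu,\mu_i)+\gamma F(\mu)$$ has a unique solution $\mu=\mathcal{N}(0,X)$, where the covariance matrix $X\in\mathbb{S}(d,\mathbb{R})_+$ solves the nonlinear matrix equation $$X-\gamma I=\sum_{i=1}^n\lambda_i\big(X^{1/2}A_iX^{1/2}\big)^{1/2}.$$ In particular, in the scalar case $d=1$, $$X=\frac{\Big[\sum_{i=1}^n\lambda_iA_i^{1/2}+\Big(\big(\sum_{i=1}^n\lambda_iA_i^{1/2}\big)^2+4\gamma\Big)^{1/2}\Big]^2}{4}.$$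
   Context: $\mathbb{S}(d,\mathbb{R})_+$ is the set of real symmetric positive definite $d\times d$ matrices, $I$ the identity matrix, $X^{1/2}$ the symmetric positive definite square root. $\mathcal{P}_2(\mathbb{R}^d)$ is the set of Borel probability measures on $\mathbb{R}^d$ with finite second moment; $W_2^2(\mu,\nu)=\inf_\pi\int|x-y|^2\,\pi(dx,dy)$ over all couplings $\pi$ of $\mu$ and $\nu$. $F(\mu)=\int_{\mathbb{R}^d}\mu(x)\log\mu(x)\,dx$ for $\mu=\mu(x)\,dx$ is the negative Boltzmann entropy, with the convention $F(\mu)=+\infty$ if $\mu$ is not absolutely continuous. *)

theory Defs
  imports "HOL-Probability.Probability"
begin

definition spd :: "real^'n^'n \<Rightarrow> bool" where
  "spd A \<longleftrightarrow> transpose A = A \<and> (\<forall>x. x \<noteq> 0 \<longrightarrow> x \<bullet> (A *v x) > 0)"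

text \<open>Meaningful for \<open>spd A\<close> only; the square root then exists and is unique.\<close>
definition spd_sqrt :: "real^'n^'n \<Rightarrow> real^'n^'n" where
  "spd_sqrt A = (THE Y. spd Y \<and> Y ** Y = A)"

definition gaussian :: "real^'n \<Rightarrow> real^'n^'n \<Rightarrow> (real^'n) measure" where
  "gaussian m A = density lborel (\<lambda>x. ennreal
     (exp (- ((x - m) \<bullet> (matrix_inv A *v (x - m))) / 2) /
      sqrt ((2 * pi) ^ CARD('n) * det A)))"

definition P2 :: "'a::euclidean_space measure set" where
  "P2 = {\<mu>. sets \<mu> = sets borel \<and> prob_space \<mu> \<and>
             (\<integral>\<^sup>+x. ennreal ((norm x)\<^sup>2) \<partial>\<mu>) < \<infinity>}"

definition couplings ::
    "'a::euclidean_space measure \<Rightarrow> 'a measure \<Rightarrow> ('a \<times> 'a) measure set" where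
  "couplings \<mu> \<nu> = {\<pi>. sets \<pi> = sets borel \<and> prob_space \<pi> \<and>
                       distr \<pi> borel fst = \<mu> \<and> distr \<pi> borel snd = \<nu>}"

definition W2_sq :: "'a::euclidean_space measure \<Rightarrow> 'a measure \<Rightarrow> ennreal" where
  "W2_sq \<mu> \<nu> = (INF \<pi>\<in>couplings \<mu> \<nu>. \<integral>\<^sup>+z. ennreal ((norm (fst z - snd z))\<^sup>2) \<partial>\<pi>)"

text \<open>
  The integral of \<open>f ln f\<close> is taken in the extended reals, as positive part minus
  negative part, because the Bochner integral returns 0 for non-integrable functions.
  For measures in \<^const>\<open>P2\<close> the negative part is finite, so no \<open>\<infinity> - \<infinity>\<close> occurs and the
  value lies in \<open>(-\<infinity>, \<infinity>]\<close>. The convention \<open>ln 0 = 0\<close> gives \<open>0 * ln 0 = 0\<close>.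
\<close>
definition neg_entropy :: "'a::euclidean_space measure \<Rightarrow> ereal" where
  "neg_entropy \<mu> =
     (if absolutely_continuous lborel \<mu> then
        let f = (\<lambda>x. enn2real (RN_deriv lborel \<mu> x)) in
          enn2ereal (\<integral>\<^sup>+x. ennreal (max 0 (f x * ln (f x))) \<partial>lborel)
        - enn2ereal (\<integral>\<^sup>+x. ennreal (max 0 (- (f x * ln (f x)))) \<partial>lborel)
      else \<infinity>)"

end

theory Submission
  imports Defs
begin

text \<open>
  The functional to be minimised dominates a relative entropy, and this is what singles out one
  Gaussian. Let \<open>X\<close> be positive definite, let \<open>T i\<close> be the positive definite matrix with
  \<open>T i ** X ** T i = A i\<close>, i.e. the linear optimal transport map from \<open>\<N>(0, X)\<close> to
  \<open>\<N>(0, A i)\<close>, and consider the quadratic dual potentials it defines. Young's inequality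
  \<open>2 x \<bullet> y \<le> x \<bullet> T x + y \<bullet> T\<^sup>-\<^sup>1 y\<close> integrates, for every coupling, to
  \<open>W\<^sub>2\<^sup>2(\<mu>, \<N>(0, A i)) \<ge> \<integral> x \<bullet> (I - T i) x d\<mu> + const\<close>, with equality when
  \<open>\<mu> = \<N>(0, X)\<close> (lemmas \<open>W2_sq_ge_dual\<close> and \<open>W2_sq_linear_image\<close>).

  The matrix equation for \<open>X\<close> says precisely that \<open>I - (\<Sum>i. lam i T i) = \<gamma> X\<^sup>-\<^sup>1\<close>
  (lemma \<open>sum_optimal_maps\<close>). Hence the weighted sum of the lower bounds is
  \<open>\<gamma>/2 \<integral> x \<bullet> X\<^sup>-\<^sup>1 x d\<mu> + const\<close>, which is \<open>-\<gamma>\<close> times the integral of the log-density of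
  \<open>\<N>(0, X)\<close>, up to a constant. Adding \<open>\<gamma>\<close> times the negative entropy gives a constant plus
  \<open>\<gamma>\<close> times the entropy of \<open>\<mu>\<close> relative to \<open>\<N>(0, X)\<close> (lemma \<open>neg_entropy_gauss\<close>). The latter
  is nonnegative and vanishes for \<open>\<N>(0, X)\<close> only (lemma \<open>relative_entropy_eq_0_iff\<close>). So
  minimality and uniqueness come together, as soon as the matrix equation has a solution.

  A solution exists by Brouwer's theorem: for suitable \<open>c\<close> the right-hand side plus \<open>\<gamma> I\<close> maps the
  compact convex set of symmetric matrices between \<open>\<gamma> I\<close> and \<open>c I\<close> into itself
  (lemma \<open>covariance_equation_solvable\<close>). Continuity of the square root is the continuity of the
  inverse of squaring, an injective map on a compact set. Square roots exist by the same
  theorem: solving \<open>(I - Z)\<^sup>2 = I - B\<close> is a fixed point problem for \<open>Z\<close>.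
\<close>

section \<open>Positive definite matrices\<close>

lemma symmetric_matrix_inner:
  fixes A :: "real^'n^'n"
  assumes "transpose A = A"
  shows "(A *v x) \<bullet> y = x \<bullet> (A *v y)"
  by (metis assms dot_lmul_matrix transpose_matrix_vector)

text \<open>
  Symmetry is checked on vectors, where sums, scalings and products of matrices simplify well.
\<close>
lemma symmetric_matrixI:
  fixes A :: "real^'n^'n"
  assumes "\<And>x y. (A *v x) \<bullet> y = x \<bullet> (A *v y)"
  shows "transpose A = A"
proof -
  have "transpose A *v x = A *v x" for x
    by (rule vector_eq_rdot[THEN iffD1]) (simp add: dot_lmul_matrix assms)
  then show ?thesis by (simp add: matrix_eq)
qed

text \<open>
  This is the Cauchy-Schwarz argument in a form that also covers degenerate quadratic forms,
  where \<open>c = 0\<close> forces \<open>b = 0\<close>.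
\<close>
lemma discriminant_nonpos:
  fixes a b c :: real
  assumes "\<And>t. 0 \<le> a - 2 * t * b + t\<^sup>2 * c" and "0 \<le> c"
  shows "b\<^sup>2 \<le> a * c"
proof (cases "c = 0")
  case True
  have "b = 0"
  proof (rule ccontr)
    assume "b \<noteq> 0"
    then show False using assms(1)[of "(a + 1) / (2 * b)"] True by simp
  qed
  then show ?thesis using True by simp
next
  case False
  with assms(2) have "0 < c" by simp
  then show ?thesis using assms(1)[of "b / c"] by (simp add: field_simps power2_eq_square)
qed

text \<open>
  The Loewner order relation \<open>p I \<le> A \<le> q I\<close>. These order intervals are compact and convex, and
  they quantify positive definiteness.
\<close>
definition spectrum_between :: "real \<Rightarrow> real \<Rightarrow> real^'n^'n \<Rightarrow> bool" where
  "spectrum_between p q A \<longleftrightarrow> transpose A = A \<and>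
     (\<forall>x. p * (x \<bullet> x) \<le> x \<bullet> (A *v x) \<and> x \<bullet> (A *v x) \<le> q * (x \<bullet> x))"

lemma spectrum_betweenD:
  assumes "spectrum_between p q A"
  shows "transpose A = A" "p * (x \<bullet> x) \<le> x \<bullet> (A *v x)" "x \<bullet> (A *v x) \<le> q * (x \<bullet> x)"
  using assms by (auto simp: spectrum_between_def)

lemma spectrum_between_le:
  assumes "spectrum_between p q (A :: real^'n^'n)"
  shows "p \<le> q"
proof -
  define e :: "real^'n" where "e = axis undefined 1"
  have "e \<bullet> e = 1" by (simp add: e_def inner_axis_axis)
  then show ?thesis using spectrum_betweenD(2,3)[OF assms, of e] by simp
qed

text \<open>
  The matrix inequality \<open>A\<^sup>2 \<le> q A\<close> for \<open>0 \<le> A \<le> q I\<close>: apply the Cauchy-Schwarz inequality of the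
  form \<open>x \<bullet> A y\<close> to \<open>x\<close> and \<open>y = A x\<close>.
\<close>
lemma psd_norm_bound:
  assumes "spectrum_between p q (A :: real^'n^'n)" "0 \<le> p"
  shows "(A *v x) \<bullet> (A *v x) \<le> q * (x \<bullet> (A *v x))"
proof (cases "A *v x = 0")
  case False
  let ?y = "A *v x"
  note sym = symmetric_matrix_inner[OF spectrum_betweenD(1)[OF assms(1)]]
  have nonneg: "0 \<le> z \<bullet> (A *v z)" for z
    using spectrum_betweenD(2)[OF assms(1), of z] mult_nonneg_nonneg[OF assms(2) inner_ge_zero[of z]] by linarith
  \<comment> \<open>The mixed term of the form at \<open>x\<close> and \<open>y\<close> is \<open>x \<bullet> A y = y \<bullet> y\<close>, by symmetry.\<close>
  have "(?y \<bullet> ?y)\<^sup>2 \<le> (x \<bullet> ?y) * (?y \<bullet> (A *v ?y))"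
  proof (rule discriminant_nonpos)
    fix t
    have "0 \<le> (x - t *\<^sub>R ?y) \<bullet> (A *v (x - t *\<^sub>R ?y))" by (rule nonneg)
    also have "\<dots> = x \<bullet> ?y - 2 * t * (?y \<bullet> ?y) + t\<^sup>2 * (?y \<bullet> (A *v ?y))"
      using sym[of x ?y]
      by (simp add: matrix_vector_mult_diff_distrib matrix_vector_mult_scaleR inner_diff_left
          inner_diff_right power2_eq_square algebra_simps)
    finally show "0 \<le> \<dots>" .
  qed (rule nonneg)
  also have "\<dots> \<le> (x \<bullet> ?y) * (q * (?y \<bullet> ?y))"
    using nonneg spectrum_betweenD(3)[OF assms(1)] by (intro mult_left_mono) auto
  finally have "(?y \<bullet> ?y) * (?y \<bullet> ?y) \<le> (q * (x \<bullet> ?y)) * (?y \<bullet> ?y)"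
    by (simp add: power2_eq_square algebra_simps)
  then show ?thesis using False by (simp)
qed simp

lemma psd_norm_le:
  assumes "spectrum_between p q (A :: real^'n^'n)" "0 \<le> p"
  shows "norm (A *v x) \<le> q * norm x"
proof -
  have "0 \<le> q" using spectrum_between_le[OF assms(1)] assms(2) by simp
  have "(A *v x) \<bullet> (A *v x) \<le> q * (q * (x \<bullet> x))"
    using psd_norm_bound[OF assms, of x] mult_left_mono[OF spectrum_betweenD(3)[OF assms(1), of x] \<open>0 \<le> q\<close>]
    by linarith
  then have "(norm (A *v x))\<^sup>2 \<le> (q * norm x)\<^sup>2"
    by (simp only: power_mult_distrib power2_norm_eq_inner power2_eq_square[of q] mult.assoc)
  then show ?thesis by (rule power2_le_imp_le) (use \<open>0 \<le> q\<close> in simp)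
qed

text \<open>
  The best constants are the extreme values of the quadratic form on the unit sphere, which are
  attained by compactness.
\<close>
lemma spd_iff_spectrum_between:
  fixes A :: "real^'n^'n"
  shows "spd A \<longleftrightarrow> (\<exists>p>0. \<exists>q. spectrum_between p q A)"
proof
  assume A: "spd A"
  let ?S = "sphere (0::real^'n) 1"
  have ne: "?S \<noteq> {}" by (simp add: sphere_eq_empty)
  have cont: "continuous_on ?S (\<lambda>x. x \<bullet> (A *v x))" by (intro continuous_intros)
  obtain u where u: "u \<in> ?S" "\<forall>x\<in>?S. u \<bullet> (A *v u) \<le> x \<bullet> (A *v x)"
    using continuous_attains_inf[OF _ ne cont] by auto
  obtain v where v: "v \<in> ?S" "\<forall>x\<in>?S. x \<bullet> (A *v x) \<le> v \<bullet> (A *v v)"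
    using continuous_attains_sup[OF _ ne cont] by auto
  have *: "x \<bullet> (A *v x) = ((x /\<^sub>R norm x) \<bullet> (A *v (x /\<^sub>R norm x))) * (x \<bullet> x)" if "x \<noteq> 0" for x
    using that by (simp add: matrix_vector_mult_scaleR dot_square_norm power2_eq_square field_simps)
  have "spectrum_between (u \<bullet> (A *v u)) (v \<bullet> (A *v v)) A"
    unfolding spectrum_between_def
  proof (intro conjI allI)
    show "transpose A = A" using A by (simp add: spd_def)
    fix x :: "real^'n"
    show "u \<bullet> (A *v u) * (x \<bullet> x) \<le> x \<bullet> (A *v x)"
    proof (cases "x = 0")
      case False
      then have "x /\<^sub>R norm x \<in> ?S" by simp
      then show ?thesis using u(2) *[OF False] by (metis inner_ge_zero mult_right_mono)
    qed simp
    show "x \<bullet> (A *v x) \<le> v \<bullet> (A *v v) * (x \<bullet> x)"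
    proof (cases "x = 0")
      case False
      then have "x /\<^sub>R norm x \<in> ?S" by simp
      then show ?thesis using v(2) *[OF False] by (metis inner_ge_zero mult_right_mono)
    qed simp
  qed
  moreover have "0 < u \<bullet> (A *v u)"
    using A u(1) unfolding spd_def by (metis dist_0_norm mem_sphere norm_zero zero_neq_one)
  ultimately show "\<exists>p>0. \<exists>q. spectrum_between p q A" by blast
next
  assume "\<exists>p>0. \<exists>q. spectrum_between p q A"
  then obtain p q where "p > 0" "spectrum_between p q A" by blast
  then show "spd A"
    unfolding spd_def spectrum_between_def
    by (metis inner_gt_zero_iff less_le_trans mult_pos_pos)
qed

lemma spectrum_between_spd:
  "spectrum_between p q A \<Longrightarrow> 0 < p \<Longrightarrow> spd A"
  using spd_iff_spectrum_between by blast

text \<open>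
  A crude comparison of the Euclidean norm of the matrix entries with the operator norm. It
  serves only to see that sets of matrices are bounded.
\<close>
lemma norm_matrix_le:
  fixes A :: "real^'n^'n"
  assumes "\<And>x. norm (A *v x) \<le> c * norm x"
  shows "norm A \<le> real (CARD('n)) * real (CARD('n)) * c"
proof -
  have entry: "\<bar>A $ i $ j\<bar> \<le> c" for i j
  proof -
    have "A $ i $ j = (A *v axis j 1) $ i" by (simp add: matrix_vector_mult_basis column_def)
    also have "\<bar>\<dots>\<bar> \<le> norm (A *v axis j 1)" by (rule component_le_norm_cart)
    also have "\<dots> \<le> c" using assms[of "axis j 1"] by simp
    finally show ?thesis .
  qed
  have "norm (A $ i) \<le> real (CARD('n)) * c" for i
  proof -
    have "norm (A $ i) \<le> (\<Sum>j\<in>UNIV. \<bar>A $ i $ j\<bar>)" by (rule norm_le_l1_cart)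
    also have "\<dots> \<le> (\<Sum>j\<in>(UNIV::'n set). c)" by (intro sum_mono entry)
    finally show ?thesis by simp
  qed
  then have "(\<Sum>i\<in>UNIV. norm (A $ i)) \<le> (\<Sum>i\<in>(UNIV::'n set). real (CARD('n)) * c)"
    by (intro sum_mono)
  moreover have "norm A \<le> (\<Sum>i\<in>UNIV. norm (A $ i))"
    unfolding norm_vec_def by (rule L2_set_le_sum) auto
  ultimately show ?thesis by simp
qed

lemma continuous_on_matrix_mult [continuous_intros]:
  fixes f g :: "'a::topological_space \<Rightarrow> real^'n^'n"
  assumes "continuous_on S f" "continuous_on S g"
  shows "continuous_on S (\<lambda>x. f x ** g x)"
  unfolding matrix_matrix_mult_def
  by (intro continuous_intros assms)

lemma continuous_on_matrix_vector [continuous_intros]: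
  fixes f :: "'a::topological_space \<Rightarrow> real^'n^'n"
  assumes "continuous_on S f"
  shows "continuous_on S (\<lambda>x. f x *v y)"
  unfolding matrix_vector_mult_def
  by (intro continuous_intros assms)

lemma continuous_on_transpose [continuous_intros]:
  fixes f :: "'a::topological_space \<Rightarrow> real^'n^'n"
  assumes "continuous_on S f"
  shows "continuous_on S (\<lambda>x. transpose (f x))"
  unfolding transpose_def
  by (intro continuous_intros assms)

lemma compact_spectrum_between:
  assumes "0 \<le> p"
  shows "compact {A :: real^'n^'n. spectrum_between p q A}" (is "compact ?K")
  unfolding compact_eq_bounded_closed
proof
  have "norm A \<le> real (CARD('n)) * real (CARD('n)) * q" if "A \<in> ?K" for A
    by (rule norm_matrix_le, rule psd_norm_le[of p]) (use that assms in auto)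
  then show "bounded ?K" by (auto simp: bounded_iff)
  have "?K = {A. transpose A = A} \<inter>
     (\<Inter>x. {A. p * (x \<bullet> x) \<le> x \<bullet> (A *v x)} \<inter> {A. x \<bullet> (A *v x) \<le> q * (x \<bullet> x)})"
    by (auto simp: spectrum_between_def)
  also have "closed \<dots>"
    by (intro closed_Int closed_INT ballI closed_Collect_eq closed_Collect_le continuous_intros)
  finally show "closed ?K" .
qed

lemma convex_spectrum_between: "convex {A :: real^'n^'n. spectrum_between p q A}"
proof (rule convexI)
  fix A B :: "real^'n^'n" and u v :: real
  assume A: "A \<in> {A. spectrum_between p q A}" and B: "B \<in> {A. spectrum_between p q A}"
    and uv: "0 \<le> u" "0 \<le> v" "u + v = 1"
  have q: "x \<bullet> ((u *\<^sub>R A + v *\<^sub>R B) *v x) = u * (x \<bullet> (A *v x)) + v * (x \<bullet> (B *v x))" for x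
    by (simp add: matrix_vector_mult_add_rdistrib scaleR_matrix_vector_assoc[symmetric] inner_add_right)
  have sy: "transpose (u *\<^sub>R A + v *\<^sub>R B) = u *\<^sub>R A + v *\<^sub>R B"
    using A B by (intro symmetric_matrixI)
      (simp add: matrix_vector_mult_add_rdistrib scaleR_matrix_vector_assoc[symmetric] inner_add_right inner_add_left
       symmetric_matrix_inner[OF spectrum_betweenD(1)])
  show "u *\<^sub>R A + v *\<^sub>R B \<in> {A. spectrum_between p q A}"
    unfolding mem_Collect_eq spectrum_between_def q
  proof (intro conjI allI sy)
    fix x :: "real^'n"
    have "p * (x \<bullet> x) = u * (p * (x \<bullet> x)) + v * (p * (x \<bullet> x))"
      using uv(3) by (metis distrib_right mult_1)
    also have "\<dots> \<le> u * (x \<bullet> (A *v x)) + v * (x \<bullet> (B *v x))"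
      using A B uv by (intro add_mono mult_left_mono) (auto simp: spectrum_betweenD)
    finally show "p * (x \<bullet> x) \<le> u * (x \<bullet> (A *v x)) + v * (x \<bullet> (B *v x))" .
    have "u * (x \<bullet> (A *v x)) + v * (x \<bullet> (B *v x)) \<le> u * (q * (x \<bullet> x)) + v * (q * (x \<bullet> x))"
      using A B uv by (intro add_mono mult_left_mono) (auto simp: spectrum_betweenD)
    also have "\<dots> = q * (x \<bullet> x)" using uv(3) by (metis distrib_right mult_1)
    finally show "u * (x \<bullet> (A *v x)) + v * (x \<bullet> (B *v x)) \<le> q * (x \<bullet> x)" .
  qed
qed

section \<open>Square roots of positive definite matrices\<close>

text \<open>
  With \<open>D = Y - Z\<close> one has \<open>Y D + D Z = Y\<^sup>2 - Z\<^sup>2 = 0\<close>. Multiplying by \<open>D\<close> and taking the trace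
  gives \<open>tr (D Y D) + tr (D Z D) = 0\<close>, a sum of values of positive definite forms at the columns
  of \<open>D\<close>, so that all these columns vanish.
\<close>
lemma spd_square_root_unique:
  fixes Y Z :: "real^'n^'n"
  assumes "spd Y" "spd Z" "Y ** Y = Z ** Z"
  shows "Y = Z"
proof -
  note symY = symmetric_matrix_inner[of Y] and symZ = symmetric_matrix_inner[of Z]
  have tY: "transpose Y = Y" and tZ: "transpose Z = Z" using assms by (auto simp: spd_def)
  define D where "D = Y - Z"
  have tD: "transpose D = D"
    by (rule symmetric_matrixI) (simp add: D_def matrix_vector_mult_diff_rdistrib inner_diff symY[OF tY] symZ[OF tZ])
  have split: "Y ** D + D ** Z = 0"
  proof -
    have "(Y ** D + D ** Z) *v x = 0" for x
      using arg_cong[OF assms(3), of "\<lambda>M. M *v x"]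
      by (simp add: D_def matrix_vector_mult_add_rdistrib matrix_vector_mult_diff_rdistrib
          matrix_vector_mul_assoc[symmetric] matrix_vector_mult_diff_distrib)
    then show ?thesis by (simp add: matrix_eq)
  qed
  have "trace (D ** (Y ** D + D ** Z)) = 0" unfolding split by (simp add: trace_def matrix_matrix_mult_def)
  then have "trace (D ** Y ** D) + trace (D ** Z ** D) = 0"
    by (metis matrix_add_ldistrib matrix_mul_assoc trace_add trace_mul_sym)
  moreover have tr: "trace (D ** M ** D) = (\<Sum>k\<in>UNIV. (D *v axis k 1) \<bullet> (M *v (D *v axis k 1)))" for M
  proof -
    have "(D ** M ** D) $ k $ k = (D *v axis k 1) \<bullet> (M *v (D *v axis k 1))" for k
    proof -
      have "(D ** M ** D) $ k $ k = ((D ** M ** D) *v axis k 1) $ k"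
        by (simp add: matrix_vector_mult_basis column_def)
      also have "\<dots> = axis k 1 \<bullet> ((D ** M ** D) *v axis k 1)"
        by (metis cart_eq_inner_axis inner_commute)
      also have "\<dots> = (D *v axis k 1) \<bullet> (M *v (D *v axis k 1))"
        by (simp only: matrix_vector_mul_assoc[symmetric] symmetric_matrix_inner[OF tD])
      finally show ?thesis .
    qed
    then show ?thesis by (simp add: trace_def)
  qed
  ultimately have sum0: "(\<Sum>k\<in>UNIV. (D *v axis k 1) \<bullet> (Y *v (D *v axis k 1)) + (D *v axis k 1) \<bullet> (Z *v (D *v axis k 1))) = 0"
    by (simp add: sum.distrib)
  have pos: "x \<bullet> (Y *v x) + x \<bullet> (Z *v x) \<ge> 0" "x \<bullet> (Y *v x) + x \<bullet> (Z *v x) = 0 \<Longrightarrow> x = 0" for x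
    using assms unfolding spd_def
    by (metis add_nonneg_nonneg inner_zero_left less_eq_real_def) (metis add_pos_pos assms(1) assms(2) less_irrefl spd_def)
  have "D *v axis k 1 = 0" for k
    using sum0 pos by (subst (asm) sum_nonneg_eq_0_iff) auto
  then have "D = 0"
    by (simp add: vec_eq_iff matrix_vector_mult_basis column_def)
  then show ?thesis by (simp add: D_def)
qed

text \<open>
  If \<open>A \<le> q I\<close>, put \<open>B = I - A / q\<close>. A matrix \<open>Z\<close> with \<open>Z = (B + Z\<^sup>2) / 2\<close> satisfies
  \<open>(I - Z)\<^sup>2 = I - B = A / q\<close>. Such a \<open>Z\<close> is a fixed point of a continuous self-map of the
  symmetric matrices of operator norm at most \<open>r\<close>, and \<open>r < 1\<close> makes \<open>I - Z\<close> positive definite.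
\<close>
lemma spd_square_root_exists:
  fixes A :: "real^'n^'n"
  assumes "spd A"
  shows "\<exists>Y. spd Y \<and> Y ** Y = A"
proof -
  obtain p q where p: "p > 0" and A: "spectrum_between p q A" using assms spd_iff_spectrum_between by blast
  have q: "q > 0" "p / q \<le> 1" using p spectrum_between_le[OF A] by auto
  define B where "B = mat 1 - (1 / q) *\<^sub>R A"
  have B: "spectrum_between 0 (1 - p / q) B"
  proof -
    have "transpose B = B"
      by (rule symmetric_matrixI)
        (simp add: B_def matrix_vector_mult_diff_rdistrib scaleR_matrix_vector_assoc[symmetric] inner_diff
          symmetric_matrix_inner[OF spectrum_betweenD(1)[OF A]])
    moreover have "x \<bullet> (B *v x) = x \<bullet> x - (x \<bullet> (A *v x)) / q" for x
      by (simp add: B_def matrix_vector_mult_diff_rdistrib scaleR_matrix_vector_assoc[symmetric] inner_diff)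
    moreover have "p * (x \<bullet> x) / q \<le> x \<bullet> (A *v x) / q" "x \<bullet> (A *v x) / q \<le> x \<bullet> x" for x
      using q spectrum_betweenD(2,3)[OF A, of x] by (auto simp: field_simps)
    ultimately show ?thesis by (simp add: spectrum_between_def left_diff_distrib)
  qed
  \<comment> \<open>\<open>r\<close> solves \<open>(\<beta> + r\<^sup>2) / 2 = r\<close> for the norm bound \<open>\<beta> = 1 - p / q\<close> of \<open>B\<close>, so the ball of radius \<open>r\<close> is preserved.\<close>
  define r where "r = 1 - sqrt (p / q)"
  have r: "0 \<le> r" "r < 1" "(1 - p / q + r * r) / 2 = r"
  proof -
    show "0 \<le> r" "r < 1" using p q by (auto simp: r_def)
    have "sqrt (p / q) * sqrt (p / q) = p / q" using p q by simp
    moreover have "(1 - P + (1 - s) * (1 - s)) / 2 = 1 - s" if "s * s = P" for s P :: real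
      using that by (auto simp: field_simps)
    ultimately show "(1 - p / q + r * r) / 2 = r" unfolding r_def by blast
  qed
  define K where "K = {Z :: real^'n^'n. transpose Z = Z \<and> (\<forall>x. norm (Z *v x) \<le> r * norm x)}"
  define F where "F Z = (1/2) *\<^sub>R (B + Z ** Z)" for Z :: "real^'n^'n"
  have Fv: "F Z *v x = (1/2) *\<^sub>R (B *v x + Z *v (Z *v x))" for Z x
    by (simp add: F_def matrix_vector_mult_add_rdistrib scaleR_matrix_vector_assoc[symmetric]
        matrix_vector_mul_assoc scaleR_add_right)
  have "\<exists>Z\<in>K. F Z = Z"
  proof (rule brouwer)
    show "compact K"
      unfolding compact_eq_bounded_closed
    proof
      have "norm Z \<le> real (CARD('n)) * real (CARD('n)) * r" if "Z \<in> K" for Z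
        using norm_matrix_le[of Z r] that by (auto simp: K_def)
      then show "bounded K" by (auto simp: bounded_iff)
      have "K = {Z. transpose Z = Z} \<inter> (\<Inter>x. {Z. norm (Z *v x) \<le> r * norm x})"
        by (auto simp: K_def)
      also have "closed \<dots>"
        by (intro closed_Int closed_INT ballI closed_Collect_eq closed_Collect_le continuous_intros)
      finally show "closed K" .
    qed
    show "convex K"
    proof (rule convexI)
      fix Y Z and u v :: real
      assume YZ: "Y \<in> K" "Z \<in> K" and uv: "0 \<le> u" "0 \<le> v" "u + v = 1"
      have "transpose (u *\<^sub>R Y + v *\<^sub>R Z) = u *\<^sub>R Y + v *\<^sub>R Z"
        using YZ by (intro symmetric_matrixI)
          (simp add: K_def matrix_vector_mult_add_rdistrib scaleR_matrix_vector_assoc[symmetric]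
             inner_add_right inner_add_left symmetric_matrix_inner)
      moreover have "norm ((u *\<^sub>R Y + v *\<^sub>R Z) *v x) \<le> r * norm x" for x
      proof -
        have "norm ((u *\<^sub>R Y + v *\<^sub>R Z) *v x) \<le> u * norm (Y *v x) + v * norm (Z *v x)"
          using uv norm_triangle_ineq[of "u *\<^sub>R (Y *v x)" "v *\<^sub>R (Z *v x)"]
          by (simp add: matrix_vector_mult_add_rdistrib scaleR_matrix_vector_assoc[symmetric])
        also have "\<dots> \<le> u * (r * norm x) + v * (r * norm x)"
          using YZ uv by (intro add_mono mult_left_mono) (auto simp: K_def)
        also have "\<dots> = r * norm x" using uv(3) by (metis distrib_right mult_1)
        finally show ?thesis .
      qed
      ultimately show "u *\<^sub>R Y + v *\<^sub>R Z \<in> K" by (simp add: K_def)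
    qed
    have "0 \<in> K" using r by (auto simp: K_def intro!: symmetric_matrixI)
    then show "K \<noteq> {}" by blast
    show "continuous_on K F" unfolding F_def by (intro continuous_intros)
    show "F \<in> K \<rightarrow> K"
    proof
      fix Z assume Z: "Z \<in> K"
      then have symZ: "transpose Z = Z" and nZ: "\<And>x. norm (Z *v x) \<le> r * norm x" by (auto simp: K_def)
      have "transpose (F Z) = F Z"
        by (rule symmetric_matrixI)
          (simp add: Fv inner_add_left inner_add_right symmetric_matrix_inner[OF symZ]
            symmetric_matrix_inner[OF spectrum_betweenD(1)[OF B]])
      moreover have "norm (F Z *v x) \<le> r * norm x" for x
      proof -
        have nZZ: "norm (Z *v (Z *v x)) \<le> r * (r * norm x)"
          using nZ[of "Z *v x"] mult_left_mono[OF nZ[of x] r(1)] by linarith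
        have "norm (F Z *v x) \<le> (norm (B *v x) + norm (Z *v (Z *v x))) / 2"
          unfolding Fv using norm_triangle_ineq[of "B *v x" "Z *v (Z *v x)"] by simp
        also have "\<dots> \<le> ((1 - p / q) * norm x + r * (r * norm x)) / 2"
          by (intro divide_right_mono add_mono psd_norm_le[OF B order_refl] nZZ) simp
        also have "\<dots> = ((1 - p / q + r * r) / 2) * norm x" by (simp add: algebra_simps)
        also have "\<dots> = r * norm x" using r(3) by simp
        finally show ?thesis .
      qed
      ultimately show "F Z \<in> K" by (simp add: K_def)
    qed
  qed blast
  then obtain Z where Z: "Z \<in> K" "F Z = Z" by blast
  have symZ: "transpose Z = Z" and nZ: "\<And>x. norm (Z *v x) \<le> r * norm x" using Z by (auto simp: K_def)
  define Y where "Y = sqrt q *\<^sub>R (mat 1 - Z)"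
  have Yv: "Y *v x = sqrt q *\<^sub>R (x - Z *v x)" for x
    by (simp add: Y_def matrix_vector_mult_diff_rdistrib scaleR_matrix_vector_assoc[symmetric])
  have "spd Y"
    unfolding spd_def
  proof (intro conjI allI impI)
    show "transpose Y = Y"
      by (rule symmetric_matrixI) (simp add: Yv inner_diff symmetric_matrix_inner[OF symZ])
    fix x :: "real^'n" assume "x \<noteq> 0"
    have "x \<bullet> (Z *v x) \<le> norm x * norm (Z *v x)" by (rule norm_cauchy_schwarz)
    also have "\<dots> \<le> norm x * (r * norm x)" using nZ by (intro mult_left_mono) auto
    also have "\<dots> = r * (x \<bullet> x)" by (simp add: dot_square_norm power2_eq_square)
    also have "\<dots> < x \<bullet> x" using r \<open>x \<noteq> 0\<close> by simp
    finally show "0 < x \<bullet> (Y *v x)" using q by (simp add: Yv inner_diff)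
  qed
  moreover have "Y ** Y = A"
  proof -
    have "(Y ** Y) *v x = A *v x" for x
    proof -
      have "2 *\<^sub>R (Z *v x) = B *v x + Z *v (Z *v x)"
        using arg_cong[OF Fv[of Z x], of "\<lambda>v. 2 *\<^sub>R v"] unfolding Z(2) scaleR_scaleR by simp
      then have "(x - Z *v x) - (Z *v x - Z *v (Z *v x)) = (1 / q) *\<^sub>R (A *v x)"
        unfolding B_def matrix_vector_mult_diff_rdistrib scaleR_matrix_vector_assoc[symmetric]
        by (simp add: scaleR_2 algebra_simps)
      then have "(x - Z *v x) - Z *v (x - Z *v x) = (1 / q) *\<^sub>R (A *v x)"
        unfolding matrix_vector_mult_diff_distrib .
      then show ?thesis using q
        by (simp add: matrix_vector_mul_assoc[symmetric] Yv matrix_vector_mult_scaleR flip: scaleR_diff_right)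
    qed
    then show ?thesis by (simp add: matrix_eq)
  qed
  ultimately show ?thesis by blast
qed

lemma spd_sqrt_eq: "spd Y \<Longrightarrow> Y ** Y = A \<Longrightarrow> spd_sqrt A = Y"
  unfolding spd_sqrt_def by (rule the_equality) (auto intro: spd_square_root_unique)

lemma spd_sqrt:
  assumes "spd A"
  shows "spd (spd_sqrt A)" "spd_sqrt A ** spd_sqrt A = A"
  using spd_square_root_exists[OF assms] spd_sqrt_eq by metis+

text \<open>
  The upper bound holds because \<open>Y = A\<^sup>1\<^sup>/\<^sup>2\<close> has \<open>|Y x|\<^sup>2 = x \<bullet> A x\<close>. The lower bound is not the
  sharp value \<open>sqrt p\<close>, but it follows at once from \<open>p |x|\<^sup>2 \<le> |Y x|\<^sup>2 \<le> sqrt q (x \<bullet> Y x)\<close>,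
  and a positive lower bound is all that the compactness argument for continuity asks for.
\<close>
lemma spectrum_between_spd_sqrt:
  fixes A :: "real^'n^'n"
  assumes A: "spectrum_between p q A" and "0 < p"
  shows "spectrum_between (p / sqrt q) (sqrt q) (spd_sqrt A)"
proof -
  define Y where "Y = spd_sqrt A"
  have Y: "spd Y" "Y ** Y = A" using spd_sqrt spectrum_between_spd[OF assms] by (auto simp: Y_def)
  then have sym: "transpose Y = Y" and pos: "0 \<le> x \<bullet> (Y *v x)" for x
    by (auto simp: spd_def) (metis inner_zero_left less_eq_real_def)
  have q: "q > 0" using spectrum_between_le[OF A] \<open>0 < p\<close> by simp
  have sq: "(Y *v x) \<bullet> (Y *v x) = x \<bullet> (A *v x)" for x
    using symmetric_matrix_inner[OF sym, of x "Y *v x"] Y(2) by (simp add: matrix_vector_mul_assoc)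
  have "norm (Y *v x) \<le> sqrt q * norm x" for x
    using spectrum_betweenD(3)[OF A, of x] sq[of x] real_sqrt_le_mono
    by (metis norm_eq_sqrt_inner real_sqrt_mult)
  then have "x \<bullet> (Y *v x) \<le> sqrt q * (x \<bullet> x)" for x
    using norm_cauchy_schwarz[of x "Y *v x"]
    by (smt (verit, ccfv_SIG) dot_square_norm mult.commute mult.left_commute mult_left_mono norm_ge_zero power2_eq_square)
  then have Y0: "spectrum_between 0 (sqrt q) Y" using sym pos by (simp add: spectrum_between_def)
  have "p * (x \<bullet> x) \<le> sqrt q * (x \<bullet> (Y *v x))" for x
    using psd_norm_bound[OF Y0, of x] sq[of x] spectrum_betweenD(2)[OF A, of x] by simp
  then show ?thesis
    using Y0 q by (auto simp: spectrum_between_def Y_def field_simps)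
qed

text \<open>
  Squaring is continuous and injective on a compact order interval of positive definite matrices,
  hence a homeomorphism onto its image, and this image contains the given order interval.
\<close>
lemma continuous_on_spd_sqrt:
  assumes "0 < p"
  shows "continuous_on {A :: real^'n^'n. spectrum_between p q A} spd_sqrt"
proof (cases "p \<le> q")
  case True
  let ?K = "{Y :: real^'n^'n. spectrum_between (p / sqrt q) (sqrt q) Y}"
  have pq: "0 < p / sqrt q" using True assms by simp
  have "continuous_on ((\<lambda>Y. Y ** Y) ` ?K) spd_sqrt"
  proof (rule continuous_on_inv)
    show "compact ?K" using pq by (intro compact_spectrum_between) simp
    show "\<forall>Y\<in>?K. spd_sqrt (Y ** Y) = Y" using spd_sqrt_eq spectrum_between_spd[OF _ pq] by auto
  qed (intro continuous_intros)
  moreover have "{A. spectrum_between p q A} \<subseteq> (\<lambda>Y. Y ** Y) ` ?K"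
  proof
    fix A :: "real^'n^'n" assume "A \<in> {A. spectrum_between p q A}"
    then have A: "spectrum_between p q A" by simp
    show "A \<in> (\<lambda>Y. Y ** Y) ` ?K"
      by (rule image_eqI[of _ _ "spd_sqrt A"])
        (simp_all add: spd_sqrt(2)[OF spectrum_between_spd[OF A assms]] spectrum_between_spd_sqrt[OF A assms])
  qed
  ultimately show ?thesis by (rule continuous_on_subset)
next
  case False
  then have "{A :: real^'n^'n. spectrum_between p q A} = {}" using spectrum_between_le by blast
  then show ?thesis by simp
qed

section \<open>Inverses and determinants\<close>

lemma matrix_inv_eqI:
  fixes A :: "real^'n^'n"
  assumes "A ** B = mat 1"
  shows "matrix_inv A = B"
proof -
  have B: "B ** A = mat 1" using assms matrix_left_right_inverse by blast
  then have "A ** matrix_inv A = mat 1"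
    unfolding matrix_inv_def by (metis (mono_tags, lifting) assms someI)
  then show ?thesis by (metis B matrix_mul_assoc matrix_mul_lid matrix_mul_rid)
qed

lemma matrix_inv_right:
  fixes A :: "real^'n^'n"
  assumes "det A \<noteq> 0"
  shows "A ** matrix_inv A = mat 1"
  using assms matrix_inv_eqI by (metis invertible_det_nz invertible_right_inverse)

lemma matrix_inv_left:
  fixes A :: "real^'n^'n"
  assumes "det A \<noteq> 0"
  shows "matrix_inv A ** A = mat 1"
  using matrix_inv_right[OF assms] matrix_left_right_inverse by blast

text \<open>
  The determinant is the square of the determinant of the square root, and a positive definite
  matrix has trivial kernel.
\<close>
lemma spd_det_pos:
  fixes A :: "real^'n^'n"
  assumes "spd A"
  shows "det A > 0"
proof -
  have nz: "det S \<noteq> 0" if "spd S" for S :: "real^'n^'n"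
    using that unfolding spd_def invertible_det_nz[symmetric] invertible_left_inverse matrix_left_invertible_ker
    by (metis inner_zero_right less_irrefl)
  have "det A = det (spd_sqrt A) * det (spd_sqrt A)"
    using spd_sqrt(2)[OF assms] by (metis det_mul)
  then show ?thesis using nz[OF spd_sqrt(1)[OF assms]] by (metis not_real_square_gt_zero)
qed

text \<open>
  The form of \<open>S A S\<close> at \<open>x\<close> is the form of \<open>A\<close> at \<open>S x\<close>, and \<open>S x\<close> vanishes for \<open>x = 0\<close> only.
\<close>
lemma spd_congruence:
  fixes A S :: "real^'n^'n"
  assumes A: "spd A" and S: "transpose S = S" "det S \<noteq> 0"
  shows "spd (S ** A ** S)"
  unfolding spd_def
proof (intro conjI allI impI)
  show "transpose (S ** A ** S) = S ** A ** S"
    using A S(1) by (simp add: spd_def matrix_transpose_mul matrix_mul_assoc)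
  fix x :: "real^'n" assume "x \<noteq> 0"
  have "x = matrix_inv S *v (S *v x)"
    using matrix_inv_left[OF S(2)] by (simp add: matrix_vector_mul_assoc)
  with \<open>x \<noteq> 0\<close> have "S *v x \<noteq> 0" by auto
  then have "0 < (S *v x) \<bullet> (A *v (S *v x))" using A by (simp add: spd_def)
  then show "0 < x \<bullet> ((S ** A ** S) *v x)"
    using symmetric_matrix_inner[OF S(1), of x] by (simp add: matrix_vector_mul_assoc[symmetric])
qed

section \<open>Solvability of the covariance equation\<close>

lemma spectrum_between_congruence:
  fixes A X :: "real^'n^'n"
  assumes A: "spectrum_between a b A" and X: "spectrum_between p q X" and "0 < a" "0 < p"
  shows "spectrum_between (a * p) (b * q) (spd_sqrt X ** A ** spd_sqrt X)"
proof -
  define S where "S = spd_sqrt X"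
  have S: "transpose S = S" "S ** S = X"
    using spd_sqrt spectrum_between_spd[OF X \<open>0 < p\<close>] by (auto simp: S_def spd_def)
  note sym = symmetric_matrix_inner[OF S(1)]
  have b: "b > 0" using spectrum_between_le[OF A] \<open>0 < a\<close> by simp
  have 1: "x \<bullet> ((S ** A ** S) *v x) = (S *v x) \<bullet> (A *v (S *v x))" for x
    by (simp add: matrix_vector_mul_assoc[symmetric] sym)
  have 2: "(S *v x) \<bullet> (S *v x) = x \<bullet> (X *v x)" for x
    using S(2) by (simp add: sym matrix_vector_mul_assoc)
  have "transpose (S ** A ** S) = S ** A ** S"
    using S(1) spectrum_betweenD(1)[OF A] by (simp add: matrix_transpose_mul matrix_mul_assoc)
  moreover have "a * p * (x \<bullet> x) \<le> (S *v x) \<bullet> (A *v (S *v x))" for x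
  proof -
    have "a * (p * (x \<bullet> x)) \<le> a * ((S *v x) \<bullet> (S *v x))"
      using spectrum_betweenD(2)[OF X, of x] \<open>0 < a\<close> 2 by simp
    then show ?thesis using spectrum_betweenD(2)[OF A, of "S *v x"] by (simp add: mult.assoc)
  qed
  moreover have "(S *v x) \<bullet> (A *v (S *v x)) \<le> b * q * (x \<bullet> x)" for x
  proof -
    have "b * ((S *v x) \<bullet> (S *v x)) \<le> b * (q * (x \<bullet> x))"
      using spectrum_betweenD(3)[OF X, of x] b 2 by simp
    then show ?thesis using spectrum_betweenD(3)[OF A, of "S *v x"] by (simp add: mult.assoc)
  qed
  ultimately show ?thesis by (simp add: spectrum_between_def 1 flip: S_def)
qed

lemma uniform_spectral_bounds:
  assumes "finite I" "I \<noteq> {}" "\<And>i. i \<in> I \<Longrightarrow> spd (A i :: real^'n^'n)"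
  obtains a b where "0 < a" "\<And>i. i \<in> I \<Longrightarrow> spectrum_between a b (A i)"
proof -
  have "\<forall>i\<in>I. \<exists>p q. 0 < p \<and> spectrum_between p q (A i)"
    using assms(3) spd_iff_spectrum_between by blast
  then obtain f g where fg: "\<And>i. i \<in> I \<Longrightarrow> 0 < f i \<and> spectrum_between (f i) (g i) (A i)"
    by metis
  show ?thesis
  proof (rule that)
    show "0 < Min (f ` I)" using assms fg by auto
    fix i assume i: "i \<in> I"
    then have "Min (f ` I) \<le> f i" "g i \<le> Max (g ` I)" using assms(1) by auto
    then show "spectrum_between (Min (f ` I)) (Max (g ` I)) (A i)"
      using fg[OF i] unfolding spectrum_between_def
      by (meson inner_ge_zero mult_right_mono order_trans)
  qed
qed

lemma sum_matrix_vector: "(\<Sum>i\<in>I. M i) *v x = (\<Sum>i\<in>I. M i *v (x :: real^'n))" for M :: "'i \<Rightarrow> real^'n^'n"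
  by (induction I rule: infinite_finite_induct) (simp_all add: matrix_vector_mult_add_rdistrib)

text \<open>
  If \<open>A i \<le> b I\<close> for all \<open>i\<close> and \<open>X \<le> c I\<close>, then the square roots on the right-hand side are at
  most \<open>sqrt (b c) I\<close>, and so is their weighted mean. The map
  \<open>X \<mapsto> \<gamma> I + (\<Sum>i. lam i (X\<^sup>1\<^sup>/\<^sup>2 A i X\<^sup>1\<^sup>/\<^sup>2)\<^sup>1\<^sup>/\<^sup>2)\<close> preserves the interval from \<open>\<gamma> I\<close> to \<open>c I\<close>
  as soon as \<open>\<gamma> + sqrt (b c) \<le> c\<close>.
\<close>
theorem covariance_equation_solvable:
  fixes A :: "'i \<Rightarrow> real^'n^'n" and lam :: "'i \<Rightarrow> real"
  assumes I: "finite I" and lam: "\<And>i. i \<in> I \<Longrightarrow> 0 \<le> lam i" "(\<Sum>i\<in>I. lam i) = 1"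
    and "0 < \<gamma>" and A: "\<And>i. i \<in> I \<Longrightarrow> spd (A i)"
  shows "\<exists>X. spd X \<and> X - \<gamma> *\<^sub>R mat 1 = (\<Sum>i\<in>I. lam i *\<^sub>R spd_sqrt (spd_sqrt X ** A i ** spd_sqrt X))"
proof -
  have "I \<noteq> {}" using lam(2) by auto
  obtain a b where a: "0 < a" and ab: "\<And>i. i \<in> I \<Longrightarrow> spectrum_between a b (A i)"
    using uniform_spectral_bounds[OF I \<open>I \<noteq> {}\<close>, of A] A by blast
  have b: "b > 0" using ab \<open>I \<noteq> {}\<close> spectrum_between_le a by (metis all_not_in_conv less_le_trans)
  \<comment> \<open>By the arithmetic-geometric mean inequality \<open>\<gamma> + sqrt (b c) \<le> \<gamma> + (b + c) / 2\<close>, which equals \<open>c\<close> for this choice.\<close>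
  define c where "c = 2 * \<gamma> + b"
  have c: "\<gamma> + sqrt (b * c) \<le> c" "0 < c"
    using arith_geo_mean_sqrt[of b c] b \<open>0 < \<gamma>\<close> by (auto simp: c_def field_simps)
  let ?K = "{X :: real^'n^'n. spectrum_between \<gamma> c X}"
  define R where "R i X = spd_sqrt (spd_sqrt X ** A i ** spd_sqrt X)" for i X
  define \<Phi> where "\<Phi> X = \<gamma> *\<^sub>R mat 1 + (\<Sum>i\<in>I. lam i *\<^sub>R R i X)" for X
  have cong: "spectrum_between (a * \<gamma>) (b * c) (spd_sqrt X ** A i ** spd_sqrt X)" if "X \<in> ?K" "i \<in> I" for X i
    using spectrum_between_congruence[OF ab[OF that(2)] _ a \<open>0 < \<gamma>\<close>] that(1) by auto
  have R: "spectrum_between (a * \<gamma> / sqrt (b * c)) (sqrt (b * c)) (R i X)" if "X \<in> ?K" "i \<in> I" for X i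
    unfolding R_def using spectrum_between_spd_sqrt[OF cong[OF that]] a \<open>0 < \<gamma>\<close> by simp
  have \<Phi>v: "\<Phi> X *v x = \<gamma> *\<^sub>R x + (\<Sum>i\<in>I. lam i *\<^sub>R (R i X *v x))" for X x
    by (simp add: \<Phi>_def matrix_vector_mult_add_rdistrib scaleR_matrix_vector_assoc[symmetric] sum_matrix_vector)
  have "\<exists>X\<in>?K. \<Phi> X = X"
  proof (rule brouwer)
    show "compact ?K" using \<open>0 < \<gamma>\<close> by (intro compact_spectrum_between) simp
    show "convex ?K" by (rule convex_spectrum_between)
    have "\<gamma> *\<^sub>R mat 1 \<in> ?K" using \<open>0 < \<gamma>\<close> b
      by (auto simp: spectrum_between_def transpose_scalar scaleR_matrix_vector_assoc[symmetric] c_def algebra_simps)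
    then show "?K \<noteq> {}" by blast
    have "continuous_on ?K (\<lambda>X. R i X)" if "i \<in> I" for i
      unfolding R_def
    proof (rule continuous_on_compose2[OF continuous_on_spd_sqrt])
      show "0 < a * \<gamma>" using a \<open>0 < \<gamma>\<close> by simp
      show "continuous_on ?K (\<lambda>X. spd_sqrt X ** A i ** spd_sqrt X)"
        by (intro continuous_intros continuous_on_spd_sqrt \<open>0 < \<gamma>\<close>)
      show "(\<lambda>X. spd_sqrt X ** A i ** spd_sqrt X) ` ?K \<subseteq> {Y. spectrum_between (a * \<gamma>) (b * c) Y}"
        using cong[OF _ that] by auto
    qed
    then show "continuous_on ?K \<Phi>" unfolding \<Phi>_def by (intro continuous_intros) auto
    show "\<Phi> \<in> ?K \<rightarrow> ?K"
    proof
      fix X :: "real^'n^'n" assume X: "X \<in> ?K"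
      have sym: "transpose (\<Phi> X) = \<Phi> X"
        using symmetric_matrix_inner[OF spectrum_betweenD(1)[OF R[OF X]]]
        by (intro symmetric_matrixI) (simp add: \<Phi>v inner_add_left inner_add_right inner_sum_left inner_sum_right)
      have q: "x \<bullet> (\<Phi> X *v x) = \<gamma> * (x \<bullet> x) + (\<Sum>i\<in>I. lam i * (x \<bullet> (R i X *v x)))" for x
        by (simp add: \<Phi>v inner_add_right inner_sum_right)
      have lo: "0 \<le> (\<Sum>i\<in>I. lam i * (x \<bullet> (R i X *v x)))" for x
      proof (intro sum_nonneg mult_nonneg_nonneg lam(1))
        fix i assume "i \<in> I"
        have "0 \<le> (a * \<gamma> / sqrt (b * c)) * (x \<bullet> x)" using a b c \<open>0 < \<gamma>\<close> by simp
        then show "0 \<le> x \<bullet> (R i X *v x)"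
          using spectrum_betweenD(2)[OF R[OF X \<open>i \<in> I\<close>], of x] by linarith
      qed
      have hi: "(\<Sum>i\<in>I. lam i * (x \<bullet> (R i X *v x))) \<le> sqrt (b * c) * (x \<bullet> x)" for x
      proof -
        have "(\<Sum>i\<in>I. lam i * (x \<bullet> (R i X *v x))) \<le> (\<Sum>i\<in>I. lam i * (sqrt (b * c) * (x \<bullet> x)))"
          using spectrum_betweenD(3)[OF R[OF X]] lam(1) by (intro sum_mono mult_left_mono) auto
        also have "\<dots> = sqrt (b * c) * (x \<bullet> x)" using lam(2) by (simp flip: sum_distrib_right)
        finally show ?thesis .
      qed
      have "x \<bullet> (\<Phi> X *v x) \<le> c * (x \<bullet> x)" for x
      proof -
        have "x \<bullet> (\<Phi> X *v x) \<le> (\<gamma> + sqrt (b * c)) * (x \<bullet> x)" using q[of x] hi[of x] by (simp add: distrib_right)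
        also have "\<dots> \<le> c * (x \<bullet> x)" using c(1) by (intro mult_right_mono) auto
        finally show ?thesis .
      qed
      then show "\<Phi> X \<in> ?K" using sym q lo by (simp add: spectrum_between_def)
    qed
  qed blast
  then obtain X where "X \<in> ?K" and X: "\<Phi> X = X" by blast
  then have "spd X" using spectrum_between_spd \<open>0 < \<gamma>\<close> by blast
  moreover have "X - \<gamma> *\<^sub>R mat 1 = (\<Sum>i\<in>I. lam i *\<^sub>R R i X)"
    using X unfolding \<Phi>_def by (simp add: algebra_simps)
  ultimately show ?thesis unfolding R_def by blast
qed

section \<open>Optimal linear maps between covariances\<close>

text \<open>
  The witness is \<open>T = X\<^sup>-\<^sup>1\<^sup>/\<^sup>2 (X\<^sup>1\<^sup>/\<^sup>2 A X\<^sup>1\<^sup>/\<^sup>2)\<^sup>1\<^sup>/\<^sup>2 X\<^sup>-\<^sup>1\<^sup>/\<^sup>2\<close>. The second property pushes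
  \<open>\<N>(0, X)\<close> forward to \<open>\<N>(0, A)\<close>; the third links \<open>T\<close> to the matrix equation.
\<close>
lemma optimal_map_exists:
  fixes X A :: "real^'n^'n"
  assumes X: "spd X" and A: "spd A"
  shows "\<exists>T. spd T \<and> T ** X ** T = A \<and>
    spd_sqrt X ** T ** spd_sqrt X = spd_sqrt (spd_sqrt X ** A ** spd_sqrt X)"
proof -
  define S R where "S = spd_sqrt X" and "R = spd_sqrt (S ** A ** S)"
  define V where "V = matrix_inv S"
  have S: "spd S" "S ** S = X" using spd_sqrt[OF X] by (auto simp: S_def)
  then have symS: "transpose S = S" and detS: "det S \<noteq> 0"
    using spd_det_pos[OF S(1)] by (auto simp: spd_def)
  have R: "spd R" "R ** R = S ** A ** S"
    using spd_sqrt[OF spd_congruence[OF A symS detS]] by (auto simp: R_def)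
  have SV: "S ** V = mat 1" and VS: "V ** S = mat 1"
    using matrix_inv_right[OF detS] matrix_inv_left[OF detS] by (auto simp: V_def)
  have "S ** transpose V = mat 1"
    using arg_cong[OF VS, of transpose] by (simp add: matrix_transpose_mul symS)
  then have symV: "transpose V = V" unfolding V_def by (rule matrix_inv_eqI[symmetric])
  have detV: "det V \<noteq> 0" using arg_cong[OF SV, of det] by (auto simp: det_mul)
  have cancel: "M ** S ** V = M" "M ** V ** S = M" "M ** R ** R = M ** S ** A ** S" for M
    using SV VS R(2) by (metis matrix_mul_assoc matrix_mul_rid)+
  have "V ** R ** V ** X ** (V ** R ** V) = A"
    by (simp add: S(2)[symmetric] matrix_mul_assoc cancel VS)
  moreover have "S ** (V ** R ** V) ** S = R"
    by (simp add: matrix_mul_assoc cancel SV)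
  ultimately show ?thesis
    using spd_congruence[OF R(1) symV detV] unfolding R_def S_def by blast
qed

text \<open>
  Multiplying the equation by \<open>X\<^sup>-\<^sup>1\<^sup>/\<^sup>2\<close> from both sides turns it into
  \<open>I - \<gamma> X\<^sup>-\<^sup>1 = (\<Sum>i. lam i T i)\<close>, stated here for the quadratic forms. The substitution
  \<open>y = X\<^sup>-\<^sup>1\<^sup>/\<^sup>2 x\<close> carries this out.
\<close>
lemma sum_optimal_maps:
  fixes X :: "real^'n^'n" and T :: "'i \<Rightarrow> real^'n^'n"
  assumes X: "spd X" and eq: "X - \<gamma> *\<^sub>R mat 1 = (\<Sum>i\<in>I. lam i *\<^sub>R (spd_sqrt X ** T i ** spd_sqrt X))"
  shows "(\<Sum>i\<in>I. lam i * (x \<bullet> (T i *v x))) = x \<bullet> x - \<gamma> * (x \<bullet> (matrix_inv X *v x))"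
proof -
  define S where "S = spd_sqrt X"
  have S: "spd S" "S ** S = X" using spd_sqrt[OF X] by (auto simp: S_def)
  then have sym: "transpose S = S" and detS: "det S \<noteq> 0"
    using spd_det_pos[OF S(1)] by (auto simp: spd_def)
  note symS = symmetric_matrix_inner[OF sym]
  define y where "y = matrix_inv S *v x"
  have x: "S *v y = x"
    using matrix_inv_right[OF detS] by (simp add: y_def matrix_vector_mul_assoc)
  have "X ** (matrix_inv S ** matrix_inv S) = mat 1"
    using matrix_inv_right[OF detS] S(2) by (metis matrix_mul_assoc matrix_mul_rid)
  then have "matrix_inv X = matrix_inv S ** matrix_inv S" by (rule matrix_inv_eqI)
  then have "x \<bullet> (matrix_inv X *v x) = (S *v y) \<bullet> (matrix_inv S *v y)"
    unfolding x by (simp add: matrix_vector_mul_assoc[symmetric] y_def)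
  also have "\<dots> = y \<bullet> (S *v (matrix_inv S *v y))" by (rule symS)
  also have "\<dots> = y \<bullet> y"
    using matrix_inv_right[OF detS] by (simp add: matrix_vector_mul_assoc)
  finally have yy: "x \<bullet> (matrix_inv X *v x) = y \<bullet> y" .
  have "y \<bullet> (X *v y) = x \<bullet> x"
    unfolding S(2)[symmetric] matrix_vector_mul_assoc[symmetric] x using symS[of y x] x by simp
  then have "x \<bullet> x - \<gamma> * (y \<bullet> y) = y \<bullet> ((X - \<gamma> *\<^sub>R mat 1) *v y)"
    by (simp add: matrix_vector_mult_diff_rdistrib scaleR_matrix_vector_assoc[symmetric] inner_diff_right)
  also have "\<dots> = (\<Sum>i\<in>I. lam i * (y \<bullet> (S *v (T i *v x))))"
    unfolding eq sum_matrix_vector S_def[symmetric]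
    by (simp add: inner_sum_right scaleR_matrix_vector_assoc[symmetric] matrix_vector_mul_assoc[symmetric] x)
  also have "\<dots> = (\<Sum>i\<in>I. lam i * (x \<bullet> (T i *v x)))"
    unfolding symS[symmetric] x ..
  finally show ?thesis by (simp add: yy)
qed

section \<open>The scalar covariance equation\<close>

lemma spd_diagonal_pos:
  fixes M :: "real^'n^'n"
  assumes "spd M"
  shows "0 < M $ k $ k"
proof -
  have "0 < axis k 1 \<bullet> (M *v axis k 1)" using assms by (simp add: spd_def axis_eq_0_iff)
  then show ?thesis by (simp add: matrix_vector_mult_basis column_def inner_axis')
qed

lemma scalar_spd_sqrt:
  fixes M :: "real^'n^'n"
  assumes "CARD('n) = 1" "spd M"
  shows "spd_sqrt M $ k $ k = sqrt (M $ k $ k)"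
proof -
  have U: "UNIV = {k}" using assms(1) by (metis UNIV_I card_1_singletonE singletonD)
  let ?Y = "spd_sqrt M"
  have Y: "spd ?Y" "?Y ** ?Y = M" using spd_sqrt[OF assms(2)] by auto
  have "0 < ?Y $ k $ k" by (rule spd_diagonal_pos[OF Y(1)])
  moreover have "?Y $ k $ k * ?Y $ k $ k = M $ k $ k"
    using arg_cong[OF Y(2), of "\<lambda>M. M $ k $ k"] by (simp add: matrix_matrix_mult_def U)
  ultimately show ?thesis by (metis less_eq_real_def real_sqrt_unique power2_eq_square)
qed

text \<open>
  In dimension one the equation reads \<open>s\<^sup>2 - \<gamma> = s m\<close> for \<open>s = sqrt X > 0\<close>. The larger root is
  the right one, since \<open>s\<^sup>2 > s m\<close> gives \<open>s > m\<close> and therefore \<open>2 s - m > 0\<close>.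
\<close>
lemma scalar_covariance:
  fixes X :: "real^'n^'n" and A :: "'i \<Rightarrow> real^'n^'n"
  assumes card: "CARD('n) = 1" and X: "spd X" and A: "\<And>i. i \<in> I \<Longrightarrow> spd (A i)" and \<gamma>: "0 < \<gamma>"
    and lam: "\<And>i. i \<in> I \<Longrightarrow> 0 \<le> lam i"
    and eq: "X - \<gamma> *\<^sub>R mat 1 = (\<Sum>i\<in>I. lam i *\<^sub>R spd_sqrt (spd_sqrt X ** A i ** spd_sqrt X))"
  shows "X $ k $ k = ((\<Sum>i\<in>I. lam i * sqrt (A i $ k $ k))
    + sqrt ((\<Sum>i\<in>I. lam i * sqrt (A i $ k $ k))\<^sup>2 + 4 * \<gamma>))\<^sup>2 / 4"
proof -
  have U: "UNIV = {k}" using card by (metis UNIV_I card_1_singletonE singletonD)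
  define m where "m = (\<Sum>i\<in>I. lam i * sqrt (A i $ k $ k))"
  define s where "s = sqrt (X $ k $ k)"
  have s: "s > 0" "s\<^sup>2 = X $ k $ k" using spd_diagonal_pos[OF X, of k] by (auto simp: s_def)
  have S: "spd (spd_sqrt X)" by (rule spd_sqrt(1)[OF X])
  have root: "spd_sqrt (spd_sqrt X ** A i ** spd_sqrt X) $ k $ k = s * sqrt (A i $ k $ k)" if "i \<in> I" for i
  proof -
    have "spd (spd_sqrt X ** A i ** spd_sqrt X)"
      using A[OF that] S spd_det_pos[OF S] by (intro spd_congruence) (auto simp: spd_def)
    then have "spd_sqrt (spd_sqrt X ** A i ** spd_sqrt X) $ k $ k = sqrt ((spd_sqrt X ** A i ** spd_sqrt X) $ k $ k)"
      by (rule scalar_spd_sqrt[OF card])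
    also have "(spd_sqrt X ** A i ** spd_sqrt X) $ k $ k = s\<^sup>2 * A i $ k $ k"
      by (simp add: matrix_matrix_mult_def U scalar_spd_sqrt[OF card X] power2_eq_square flip: s_def)
    finally show ?thesis using s(1) by (simp add: real_sqrt_mult)
  qed
  have "X $ k $ k - \<gamma> = (\<Sum>i\<in>I. lam i * (s * sqrt (A i $ k $ k)))"
    using arg_cong[OF eq, of "\<lambda>M. M $ k $ k"] by (simp add: mat_def root)
  then have quad: "s\<^sup>2 - \<gamma> = s * m"
    by (simp add: s m_def sum_distrib_left mult_ac)
  then have "(2 * s - m)\<^sup>2 = m\<^sup>2 + 4 * \<gamma>" by (simp add: power2_eq_square algebra_simps)
  moreover have "0 \<le> 2 * s - m"
  proof -
    have "s * m \<le> s * s" using quad \<gamma> by (simp add: power2_eq_square)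
    then show ?thesis using s(1) by simp
  qed
  ultimately have "sqrt (m\<^sup>2 + 4 * \<gamma>) = 2 * s - m" by (metis real_sqrt_unique)
  then show ?thesis using s(2) by (simp add: power2_eq_square flip: m_def)
qed

section \<open>Lebesgue measure under linear maps\<close>

text \<open>
  Integrate over the coordinate \<open>m\<close> first: for fixed values of the other coordinates the shear
  is a translation of the real line.
\<close>
lemma nn_integral_lborel_shear:
  fixes f :: "'a::euclidean_space \<Rightarrow> ennreal"
  assumes f [measurable]: "f \<in> borel_measurable borel" and mn: "m \<in> Basis" "n \<in> Basis" "m \<noteq> n"
  shows "(\<integral>\<^sup>+x. f (x + (c * (x \<bullet> n)) *\<^sub>R m) \<partial>lborel) = (\<integral>\<^sup>+x. f x \<partial>lborel)"
proof -
  interpret product_sigma_finite "\<lambda>_::'a. lborel :: real measure" by standard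
  let ?B = "Basis - {m}"
  have B: "Basis = insert m ?B" using mn by auto
  define E where "E y = (\<Sum>b\<in>Basis. y b *\<^sub>R b)" for y :: "'a \<Rightarrow> real"
  define w where "w y = (\<Sum>b\<in>?B. y b *\<^sub>R b)" for y :: "'a \<Rightarrow> real"
  have E_meas [measurable]: "E \<in> borel_measurable (\<Pi>\<^sub>M b\<in>Basis. lborel)"
    unfolding E_def by measurable
  have E_upd: "E (y(m := t)) = t *\<^sub>R m + w y" for y t
    unfolding E_def w_def using mn by (subst sum.remove[of _ m]) (auto intro!: sum.cong)
  have wm: "w y \<bullet> n = y n" for y
    using mn by (simp add: w_def inner_sum_left inner_Basis if_distrib if_distribR cong: if_cong)
  have En: "E (y(m := t)) \<bullet> n = y n" for y t
    using mn by (simp add: E_upd inner_add_left wm inner_Basis)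
  \<comment> \<open>Fubini, with the coordinate \<open>m\<close> innermost.\<close>
  have iter: "(\<integral>\<^sup>+x. g x \<partial>lborel) =
      (\<integral>\<^sup>+y. (\<integral>\<^sup>+t. g (E (y(m := t))) \<partial>lborel) \<partial>(\<Pi>\<^sub>M b\<in>?B. lborel))"
    if [measurable]: "g \<in> borel_measurable borel" for g :: "'a \<Rightarrow> ennreal"
  proof -
    have "(\<integral>\<^sup>+x. g x \<partial>lborel) = (\<integral>\<^sup>+y. g (E y) \<partial>(\<Pi>\<^sub>M b\<in>Basis. lborel))"
      by (subst lborel_eq) (simp add: nn_integral_distr flip: E_def)
    also have "\<dots> = (\<integral>\<^sup>+y. g (E y) \<partial>(\<Pi>\<^sub>M b\<in>insert m ?B. lborel))"
      using B by simp
    also have "\<dots> = (\<integral>\<^sup>+y. (\<integral>\<^sup>+t. g (E (y(m := t))) \<partial>lborel) \<partial>(\<Pi>\<^sub>M b\<in>?B. lborel))"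
    proof (rule product_nn_integral_insert)
      show "(\<lambda>y. g (E y)) \<in> borel_measurable (\<Pi>\<^sub>M b\<in>insert m ?B. lborel)"
        unfolding B[symmetric] by measurable
    qed auto
    finally show ?thesis .
  qed
  have "(\<integral>\<^sup>+x. f (x + (c * (x \<bullet> n)) *\<^sub>R m) \<partial>lborel) =
      (\<integral>\<^sup>+y. (\<integral>\<^sup>+t. f (((c * y n) + 1 * t) *\<^sub>R m + w y) \<partial>lborel) \<partial>(\<Pi>\<^sub>M b\<in>?B. lborel))"
    by (subst iter, measurable, intro nn_integral_cong, simp only: En, simp add: E_upd algebra_simps)
  also have "\<dots> = (\<integral>\<^sup>+y. (\<integral>\<^sup>+t. f (t *\<^sub>R m + w y) \<partial>lborel) \<partial>(\<Pi>\<^sub>M b\<in>?B. lborel))"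
  proof (rule nn_integral_cong)
    fix y
    show "(\<integral>\<^sup>+t. f (((c * y n) + 1 * t) *\<^sub>R m + w y) \<partial>lborel) = (\<integral>\<^sup>+t. f (t *\<^sub>R m + w y) \<partial>lborel)"
      using nn_integral_real_affine[of "\<lambda>t. f (t *\<^sub>R m + w y)" 1 "c * y n"] by simp
  qed
  also have "\<dots> = (\<integral>\<^sup>+x. f x \<partial>lborel)" by (subst iter) (auto simp: E_upd)
  finally show ?thesis .
qed

lemma Basis_cart: "(Basis :: (real^'n) set) = range (\<lambda>i. axis i 1)"
  by (auto simp: Basis_vec_def)

lemma prod_Basis_cart: "(\<Prod>b\<in>Basis. g b) = (\<Prod>i\<in>UNIV. g (axis i (1::real) :: real^'n))"
  unfolding Basis_cart by (subst prod.reindex) (auto simp: inj_on_def axis_eq_axis)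

lemma sum_Basis_cart: "(\<Sum>b\<in>Basis. g b) = (\<Sum>i\<in>UNIV. g (axis i (1::real) :: real^'n))"
  unfolding Basis_cart by (subst sum.reindex) (auto simp: inj_on_def axis_eq_axis)

lemma matrix_vector_borel_measurable [measurable]: "(\<lambda>x. (A :: real^'n^'m) *v x) \<in> borel_measurable borel"
  by (intro borel_measurable_continuous_onI continuous_intros)

text \<open>
  The formula is multiplicative in the matrix, so it suffices to check it for the matrices that
  generate all others: diagonal matrices, transpositions of coordinates, and shears. Singular
  matrices with a zero row are excluded by the determinant.
\<close>
theorem nn_integral_lborel_linear:
  fixes A :: "real^'n^'n"
  assumes "det A \<noteq> 0" and "f \<in> borel_measurable borel"
  shows "(\<integral>\<^sup>+x. f x \<partial>lborel) = ennreal \<bar>det A\<bar> * (\<integral>\<^sup>+x. f (A *v x) \<partial>lborel)"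
proof -
  define P where "P A \<longleftrightarrow> (det A \<noteq> 0 \<longrightarrow> (\<forall>f \<in> borel_measurable borel.
     (\<integral>\<^sup>+x. f x \<partial>lborel) = ennreal \<bar>det A\<bar> * (\<integral>\<^sup>+x. f (A *v x) \<partial>lborel)))" for A :: "real^'n^'n"
  have "P A"
  proof (rule induct_matrix_elementary)
    fix A B assume "P A" "P B"
    show "P (A ** B)"
      unfolding P_def
    proof (intro impI ballI)
      fix f :: "real^'n \<Rightarrow> ennreal"
      assume d: "det (A ** B) \<noteq> 0" and [measurable]: "f \<in> borel_measurable borel"
      then have "det A \<noteq> 0" "det B \<noteq> 0" by (auto simp: det_mul)
      have "(\<integral>\<^sup>+x. f x \<partial>lborel) = ennreal \<bar>det A\<bar> * (\<integral>\<^sup>+x. f (A *v x) \<partial>lborel)"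
        by (rule \<open>P A\<close>[unfolded P_def, rule_format]) fact+
      moreover have "(\<integral>\<^sup>+x. f (A *v x) \<partial>lborel) = ennreal \<bar>det B\<bar> * (\<integral>\<^sup>+x. f (A *v (B *v x)) \<partial>lborel)"
        by (rule \<open>P B\<close>[unfolded P_def, rule_format, where f="\<lambda>x. f (A *v x)"]) (fact, measurable)
      ultimately show "(\<integral>\<^sup>+x. f x \<partial>lborel) = ennreal \<bar>det (A ** B)\<bar> * (\<integral>\<^sup>+x. f (A ** B *v x) \<partial>lborel)"
        by (simp add: det_mul abs_mult ennreal_mult mult.assoc matrix_vector_mul_assoc)
    qed
  next
    fix A :: "real^'n^'n" and i assume "row i A = 0"
    then show "P A" using det_zero_row[of i A] by (simp add: P_def)
  next
    fix A :: "real^'n^'n" assume diag: "\<And>i j. i \<noteq> j \<Longrightarrow> A $ i $ j = 0"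
    show "P A"
      unfolding P_def
    proof (intro impI ballI)
      fix f :: "real^'n \<Rightarrow> ennreal"
      assume d: "det A \<noteq> 0" and [measurable]: "f \<in> borel_measurable borel"
      define c where "c b = b \<bullet> (A *v b)" for b
      have c_axis: "c (axis i 1) = A $ i $ i" for i
        by (simp add: c_def matrix_vector_mult_basis column_def inner_axis')
      have det: "det A = (\<Prod>i\<in>UNIV. A $ i $ i)" by (rule det_diagonal) (use diag in auto)
      have T: "0 + (\<Sum>j\<in>Basis. (c j * (x \<bullet> j)) *\<^sub>R j) = A *v x" for x
      proof -
        have "(A *v x) $ k = A $ k $ k * x $ k" for k
        proof -
          have "(A *v x) $ k = (\<Sum>j\<in>UNIV. A $ k $ j * x $ j)" by (simp add: matrix_vector_mult_def)
          also have "\<dots> = (\<Sum>j\<in>{k}. A $ k $ j * x $ j)"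
            by (rule sum.mono_neutral_right) (auto simp: diag)
          finally show ?thesis by simp
        qed
        moreover have "(\<Sum>j\<in>Basis. (c j * (x \<bullet> j)) *\<^sub>R j) = (\<Sum>i\<in>UNIV. (A $ i $ i * x $ i) *\<^sub>R axis i 1)"
          by (simp add: sum_Basis_cart c_axis inner_axis)
        ultimately show ?thesis
          by (simp add: vec_eq_iff axis_def if_distrib cong: if_cong)
      qed
      have "(\<integral>\<^sup>+x. f x \<partial>lborel) =
        (\<integral>\<^sup>+x. f x \<partial>density (distr lborel borel (\<lambda>x. 0 + (\<Sum>j\<in>Basis. (c j * (x \<bullet> j)) *\<^sub>R j)))
          (\<lambda>_. ennreal (\<Prod>j\<in>Basis. \<bar>c j\<bar>)))"
        by (subst lborel_affine_euclidean[of c 0]) (use d det in \<open>auto simp: Basis_cart c_axis\<close>)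
      also have "\<dots> = ennreal (\<Prod>j\<in>Basis. \<bar>c j\<bar>) * (\<integral>\<^sup>+x. f (A *v x) \<partial>lborel)"
        unfolding T by (simp add: nn_integral_density nn_integral_distr nn_integral_cmult)
      also have "(\<Prod>j\<in>Basis. \<bar>c j\<bar>) = \<bar>det A\<bar>"
        by (simp add: prod_Basis_cart c_axis det abs_prod)
      finally show "(\<integral>\<^sup>+x. f x \<partial>lborel) = ennreal \<bar>det A\<bar> * (\<integral>\<^sup>+x. f (A *v x) \<partial>lborel)" .
    qed
  next
    fix m n :: 'n assume "m \<noteq> n"
    let ?s = "Transposition.transpose m n"
    let ?A = "(\<chi> i j. mat 1 $ i $ ?s j) :: real^'n^'n"
    have det: "\<bar>det ?A\<bar> = 1"
      by (simp add: det_permute_columns permutes_swap_id sign_swap_id abs_mult)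
    have Av: "?A *v x = (\<chi> i. x $ ?s i)" for x
    proof -
      have "(?A *v x) $ i = x $ ?s i" for i
      proof -
        have "(?A *v x) $ i = (\<Sum>j\<in>UNIV. (if i = ?s j then 1 else 0) * x $ j)"
          by (simp add: matrix_vector_mult_def mat_def)
        also have "\<dots> = (\<Sum>j\<in>UNIV. (if j = ?s i then x $ j else 0))"
          by (intro sum.cong) (auto simp: transpose_eq_iff)
        finally show ?thesis by simp
      qed
      then show ?thesis by (simp add: vec_eq_iff)
    qed
    have eq: "lborel = distr lborel borel (\<lambda>x. ?A *v x)"
    proof (rule lborel_eqI)
      fix l u :: "real^'n" assume le: "\<And>b. b \<in> Basis \<Longrightarrow> l \<bullet> b \<le> u \<bullet> b"
      have le': "l $ i \<le> u $ i" for i using le[of "axis i 1"] by (simp add: inner_axis Basis_cart)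
      have "(\<lambda>x. ?A *v x) -` box l u = box (?A *v l) (?A *v u)"
        unfolding Av by (auto simp: mem_box_cart) (metis transpose_involutory)+
      then have "emeasure (distr lborel borel (\<lambda>x. ?A *v x)) (box l u) = emeasure lborel (box (?A *v l) (?A *v u))"
        by (simp add: emeasure_distr)
      also have "\<dots> = ennreal (\<Prod>i\<in>UNIV. (u - l) $ ?s i)"
        using le' by (subst emeasure_lborel_box_eq)
          (auto simp: Basis_cart prod_Basis_cart[unfolded Basis_cart] inner_axis Av)
      also have "(\<Prod>i\<in>UNIV. (u - l) $ ?s i) = (\<Prod>i\<in>UNIV. (u - l) $ i)"
        by (rule prod.reindex_bij_betw) (rule bij_transpose)
      finally show "emeasure (distr lborel borel (\<lambda>x. ?A *v x)) (box l u) = ennreal (\<Prod>b\<in>Basis. (u - l) \<bullet> b)"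
        by (simp add: prod_Basis_cart inner_axis)
    qed simp
    show "P ?A"
      unfolding P_def det
    proof (intro impI ballI)
      fix f :: "real^'n \<Rightarrow> ennreal" assume [measurable]: "f \<in> borel_measurable borel"
      show "(\<integral>\<^sup>+x. f x \<partial>lborel) = ennreal 1 * (\<integral>\<^sup>+x. f (?A *v x) \<partial>lborel)"
        by (subst eq) (simp add: nn_integral_distr)
    qed
  next
    fix m n :: 'n and c :: real assume mn: "m \<noteq> n"
    let ?A = "(\<chi> i j. if i = m \<and> j = n then c else of_bool (i = j)) :: real^'n^'n"
    have "?A = (\<chi> k. if k = m then row m (mat 1) + c *s row n (mat 1) else row k (mat 1))"
      using mn by (auto simp: vec_eq_iff row_def mat_def)
    then have det: "det ?A = 1" using det_row_operation[OF mn, of "mat 1" c] by simp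
    have Av: "?A *v x = x + (c * (x \<bullet> axis n 1)) *\<^sub>R axis m 1" for x
    proof -
      have "(?A *v x) $ i = (x + (c * (x \<bullet> axis n 1)) *\<^sub>R axis m 1) $ i" for i
      proof -
        have "(?A *v x) $ i = (\<Sum>j\<in>UNIV. (if j = i then x $ j else 0) + (if j = n then (if i = m then c * x $ j else 0) else 0))"
          using mn unfolding matrix_vector_mult_def by (auto intro!: sum.cong)
        then show ?thesis by (simp add: sum.distrib inner_axis) (simp add: axis_def)
      qed
      then show ?thesis by (simp add: vec_eq_iff)
    qed
    show "P ?A"
      unfolding P_def det Av
    proof (intro impI ballI)
      fix f :: "real^'n \<Rightarrow> ennreal" assume f: "f \<in> borel_measurable borel"
      have "axis m (1::real) \<noteq> axis n 1" using mn by (simp add: axis_eq_axis)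
      then have "(\<integral>\<^sup>+x. f (x + (c * (x \<bullet> axis n 1)) *\<^sub>R axis m 1) \<partial>lborel) = (\<integral>\<^sup>+x. f x \<partial>lborel)"
        using f by (intro nn_integral_lborel_shear) (simp_all add: Basis_cart)
      then show "(\<integral>\<^sup>+x. f x \<partial>lborel) =
          ennreal \<bar>1\<bar> * (\<integral>\<^sup>+x. f (x + (c * (x \<bullet> axis n 1)) *\<^sub>R axis m 1) \<partial>lborel)"
        by simp
    qed
  qed
  then show ?thesis using assms unfolding P_def by blast
qed

section \<open>Centred Gaussian measures\<close>

text \<open>
  The density of \<open>\<N>(0, A)\<close>, by name, because it also enters as the reference density in the
  relative entropy.
\<close>
definition gauss_density :: "real^'n^'n \<Rightarrow> real^'n \<Rightarrow> real" where
  "gauss_density A x = exp (- (x \<bullet> (matrix_inv A *v x)) / 2) / sqrt ((2 * pi) ^ CARD('n) * det A)"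

lemma gauss_density_measurable [measurable]: "gauss_density A \<in> borel_measurable borel"
  unfolding gauss_density_def[abs_def] by measurable

lemma gauss_density_pos: "det A > 0 \<Longrightarrow> gauss_density A x > 0"
  by (simp add: gauss_density_def)

lemma ln_gauss_density:
  fixes A :: "real^'n^'n"
  assumes "det A > 0"
  shows "ln (gauss_density A x) = - (x \<bullet> (matrix_inv A *v x)) / 2 - ln (sqrt ((2 * pi) ^ CARD('n) * det A))"
  using assms by (simp add: gauss_density_def ln_div)

lemma gaussian_eq_density: "gaussian 0 A = density lborel (\<lambda>x. ennreal (gauss_density A x))"
  by (simp add: gaussian_def gauss_density_def)

lemma sets_gaussian [simp, measurable_cong]: "sets (gaussian 0 A) = sets borel"
  by (simp add: gaussian_def)

text \<open>
  The exponents agree because \<open>A\<^sup>-\<^sup>1 = T\<^sup>t (T A T\<^sup>t)\<^sup>-\<^sup>1 T\<close>; the normalising constants differ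
  exactly by the Jacobian of \<open>T\<close>.
\<close>
lemma gauss_density_congruence:
  fixes A T :: "real^'n^'n"
  assumes A: "det A > 0" and T: "det T \<noteq> 0"
  shows "\<bar>det T\<bar> * gauss_density (T ** A ** transpose T) (T *v x) = gauss_density A x"
proof -
  define V where "V = matrix_inv (T ** A ** transpose T)"
  have "det (T ** A ** transpose T) \<noteq> 0" using A T by (simp add: det_mul)
  then have V: "T ** (A ** transpose T ** V) = mat 1"
    using matrix_inv_right by (simp add: V_def matrix_mul_assoc)
  then have "(A ** transpose T ** V) ** T = mat 1"
    using matrix_left_right_inverse by blast
  then have Ainv: "matrix_inv A = transpose T ** V ** T"
    by (intro matrix_inv_eqI) (simp add: matrix_mul_assoc)
  have "(T *v x) \<bullet> (V *v (T *v x)) = x \<bullet> (matrix_inv A *v x)"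
    unfolding Ainv matrix_vector_mul_assoc[symmetric]
    by (metis dot_lmul_matrix transpose_transpose transpose_matrix_vector)
  moreover have "sqrt ((2 * pi) ^ CARD('n) * det (T ** A ** transpose T)) =
      \<bar>det T\<bar> * sqrt ((2 * pi) ^ CARD('n) * det A)"
    by (simp add: det_mul real_sqrt_mult)
  ultimately show ?thesis using T by (simp add: gauss_density_def V_def[symmetric])
qed

theorem distr_gaussian_linear:
  fixes A T :: "real^'n^'n"
  assumes A: "det A > 0" and T: "det T \<noteq> 0"
  shows "distr (gaussian 0 A) borel ((*v) T) = gaussian 0 (T ** A ** transpose T)"
proof (rule measure_eqI)
  fix B assume "B \<in> sets (distr (gaussian 0 A) borel ((*v) T))"
  then have [measurable]: "B \<in> sets borel" by simp
  let ?g = "\<lambda>x. ennreal (gauss_density (T ** A ** transpose T) x) * indicator B x"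
  have "emeasure (gaussian 0 (T ** A ** transpose T)) B = (\<integral>\<^sup>+x. ?g x \<partial>lborel)"
    by (simp add: gaussian_eq_density emeasure_density)
  also have "\<dots> = ennreal \<bar>det T\<bar> * (\<integral>\<^sup>+x. ?g (T *v x) \<partial>lborel)"
    by (rule nn_integral_lborel_linear[OF T]) measurable
  also have "\<dots> = (\<integral>\<^sup>+x. ennreal \<bar>det T\<bar> * ?g (T *v x) \<partial>lborel)"
    by (rule nn_integral_cmult[symmetric]) measurable
  also have "\<dots> = (\<integral>\<^sup>+x. ennreal (gauss_density A x) * indicator ((*v) T -` B) x \<partial>lborel)"
    by (intro nn_integral_cong)
      (simp add: gauss_density_congruence[OF A T, symmetric] ennreal_mult' mult.assoc split: split_indicator)
  also have "\<dots> = emeasure (distr (gaussian 0 A) borel ((*v) T)) B"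
  proof -
    have "(*v) T -` B \<in> sets borel"
      using measurable_sets[OF matrix_vector_borel_measurable[of T] \<open>B \<in> sets borel\<close>] by simp
    then show ?thesis
      by (simp add: emeasure_distr gaussian_eq_density emeasure_density)
  qed
  finally show "emeasure (distr (gaussian 0 A) borel ((*v) T)) B = emeasure (gaussian 0 (T ** A ** transpose T)) B" ..
qed simp

text \<open>
  The integrand is a product over the coordinates, and the one-dimensional factors are known. The
  case \<open>\<sigma> = 1\<close> gives the normalisation, the case \<open>\<sigma>\<^sup>2 = 2\<close> a dominating function for the second
  moment.
\<close>
lemma nn_integral_exp_norm_sq:
  assumes "\<sigma> > 0"
  shows "(\<integral>\<^sup>+x. ennreal (exp (- (norm x)\<^sup>2 / (2 * \<sigma>\<^sup>2))) \<partial>(lborel :: 'a::euclidean_space measure)) =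
    ennreal (sqrt (2 * pi * \<sigma>\<^sup>2) ^ DIM('a))"
proof -
  let ?s = "sqrt (2 * pi * \<sigma>\<^sup>2)"
  have s: "?s > 0" using assms by simp
  have 1: "(\<integral>\<^sup>+t. ennreal (exp (- t\<^sup>2 / (2 * \<sigma>\<^sup>2))) \<partial>lborel) = ennreal ?s"
  proof -
    have "(\<integral>\<^sup>+t. ennreal (exp (- t\<^sup>2 / (2 * \<sigma>\<^sup>2))) \<partial>lborel) = (\<integral>\<^sup>+t. ennreal ?s * ennreal (normal_density 0 \<sigma> t) \<partial>lborel)"
      using s assms by (intro nn_integral_cong) (simp add: normal_density_def flip: ennreal_mult')
    also have "\<dots> = ennreal ?s * (\<integral>\<^sup>+t. ennreal (normal_density 0 \<sigma> t) \<partial>lborel)"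
      by (rule nn_integral_cmult) measurable
    also have "(\<integral>\<^sup>+t. ennreal (normal_density 0 \<sigma> t) \<partial>lborel) = 1"
      using assms by (subst nn_integral_eq_integral) auto
    finally show ?thesis by simp
  qed
  have "(\<integral>\<^sup>+x. ennreal (exp (- (norm x)\<^sup>2 / (2 * \<sigma>\<^sup>2))) \<partial>(lborel :: 'a measure)) =
    (\<integral>\<^sup>+x. (\<Prod>b\<in>Basis. ennreal (exp (- (x \<bullet> b)\<^sup>2 / (2 * \<sigma>\<^sup>2)))) \<partial>(lborel :: 'a measure))"
  proof (intro nn_integral_cong)
    fix x :: 'a
    have "(norm x)\<^sup>2 = (\<Sum>b\<in>Basis. (x \<bullet> b)\<^sup>2)"
      by (subst power2_norm_eq_inner, subst euclidean_inner) (simp add: power2_eq_square)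
    then have "- (norm x)\<^sup>2 / (2 * \<sigma>\<^sup>2) = (\<Sum>b\<in>Basis. - (x \<bullet> b)\<^sup>2 / (2 * \<sigma>\<^sup>2))"
      by (simp add: sum_negf sum_divide_distrib)
    then show "ennreal (exp (- (norm x)\<^sup>2 / (2 * \<sigma>\<^sup>2))) = (\<Prod>b\<in>Basis. ennreal (exp (- (x \<bullet> b)\<^sup>2 / (2 * \<sigma>\<^sup>2))))"
      by (simp add: exp_sum prod_ennreal)
  qed
  also have "\<dots> = (\<Prod>b\<in>(Basis::'a set). \<integral>\<^sup>+t. ennreal (exp (- t\<^sup>2 / (2 * \<sigma>\<^sup>2))) \<partial>lborel)"
    by (rule nn_integral_lborel_prod) auto
  also have "\<dots> = ennreal (?s ^ DIM('a))" unfolding 1 using s by (simp add: ennreal_power)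
  finally show ?thesis .
qed

lemma gauss_density_id:
  "gauss_density (mat 1 :: real^'n^'n) x = exp (- (norm x)\<^sup>2 / 2) / sqrt (2 * pi) ^ CARD('n)"
  unfolding gauss_density_def matrix_inv_eqI[of "mat 1" "mat 1", OF matrix_mul_lid]
    matrix_vector_mul_lid det_I mult_1_right real_sqrt_power power2_norm_eq_inner by (rule refl)

lemma standard_gaussian_prob_space: "prob_space (gaussian 0 (mat 1 :: real^'n^'n))"
proof
  let ?s = "sqrt (2 * pi) ^ CARD('n)"
  have s: "?s > 0" by simp
  have "emeasure (gaussian 0 (mat 1 :: real^'n^'n)) (space (gaussian 0 (mat 1 :: real^'n^'n))) =
    (\<integral>\<^sup>+x. ennreal (1 / ?s) * ennreal (exp (- (norm x)\<^sup>2 / (2 * 1\<^sup>2))) \<partial>(lborel :: (real^'n) measure))"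
    using s by (simp add: gaussian_eq_density emeasure_density gauss_density_id flip: ennreal_mult')
  also have "\<dots> = ennreal (1 / ?s) * (\<integral>\<^sup>+x. ennreal (exp (- (norm x)\<^sup>2 / (2 * 1\<^sup>2))) \<partial>(lborel :: (real^'n) measure))"
    by (rule nn_integral_cmult) measurable
  also have "\<dots> = 1"
    by (subst nn_integral_exp_norm_sq) (simp_all flip: ennreal_mult')
  finally show "emeasure (gaussian 0 (mat 1 :: real^'n^'n)) (space (gaussian 0 (mat 1 :: real^'n^'n))) = 1" .
qed

text \<open>
  The bound \<open>r \<le> 4 exp (r / 4)\<close> at \<open>r = |x|\<^sup>2\<close> reduces the second moment to the total mass of a
  wider Gaussian.
\<close>
lemma standard_gaussian_second_moment:
  "(\<integral>\<^sup>+x. ennreal ((norm x)\<^sup>2) \<partial>(gaussian 0 (mat 1 :: real^'n^'n))) < \<infinity>"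
proof -
  let ?s = "sqrt (2 * pi) ^ CARD('n)"
  have s: "?s > 0" by simp
  have bound: "exp (- r / 2) / ?s * r \<le> 4 / ?s * exp (- r / 4)" if "0 \<le> r" for r :: real
  proof -
    \<comment> \<open>Half of the exponential decay is spent on absorbing the factor \<open>r\<close>.\<close>
    have "r \<le> 4 * exp (r / 4)" using exp_ge_add_one_self[of "r / 4"] by linarith
    then have "exp (- r / 2) * r \<le> exp (- r / 2) * (4 * exp (r / 4))" by (intro mult_left_mono) auto
    also have "\<dots> = 4 * exp (- r / 4)" by (simp flip: exp_add)
    finally show ?thesis using s by (simp add: divide_right_mono)
  qed
  have "(\<integral>\<^sup>+x. ennreal ((norm x)\<^sup>2) \<partial>(gaussian 0 (mat 1 :: real^'n^'n))) =
    (\<integral>\<^sup>+x. ennreal (exp (- (norm x)\<^sup>2 / 2) / ?s * (norm x)\<^sup>2) \<partial>(lborel :: (real^'n) measure))"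
    by (simp add: gaussian_eq_density nn_integral_density gauss_density_id flip: ennreal_mult')
  also have "\<dots> \<le> (\<integral>\<^sup>+x. ennreal (4 / ?s) * ennreal (exp (- (norm x)\<^sup>2 / (2 * (sqrt 2)\<^sup>2))) \<partial>(lborel :: (real^'n) measure))"
    using bound s by (intro nn_integral_mono) (simp flip: ennreal_mult')
  also have "\<dots> = ennreal (4 / ?s) * ennreal (sqrt (2 * pi * (sqrt 2)\<^sup>2) ^ CARD('n))"
    by (subst nn_integral_cmult, measurable, subst nn_integral_exp_norm_sq) simp_all
  also have "\<dots> < \<infinity>" by (simp add: ennreal_mult_less_top)
  finally show ?thesis .
qed

lemma gaussian_eq_distr_standard:
  fixes A :: "real^'n^'n"
  assumes "spd A"
  shows "gaussian 0 A = distr (gaussian 0 (mat 1)) borel ((*v) (spd_sqrt A))"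
proof -
  have "spd (spd_sqrt A)" "spd_sqrt A ** spd_sqrt A = A" using spd_sqrt[OF assms] by auto
  moreover from this have "det (spd_sqrt A) \<noteq> 0" using spd_det_pos by force
  ultimately show ?thesis
    using distr_gaussian_linear[of "mat 1" "spd_sqrt A"] by (simp add: spd_def)
qed

text \<open>
  Both mass and moment are inherited from the standard Gaussian, of which \<open>\<N>(0, A)\<close> is the image
  under the square root of \<open>A\<close>.
\<close>
lemma gaussian_in_P2:
  fixes A :: "real^'n^'n"
  assumes "spd A"
  shows "gaussian 0 A \<in> P2"
proof -
  let ?G = "gaussian 0 (mat 1 :: real^'n^'n)" and ?S = "spd_sqrt A"
  interpret G: prob_space ?G by (rule standard_gaussian_prob_space)
  obtain p q where q: "0 < p" "spectrum_between p q ?S"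
    using spd_sqrt(1)[OF assms] spd_iff_spectrum_between by blast
  have bound: "(norm (?S *v x))\<^sup>2 \<le> q\<^sup>2 * (norm x)\<^sup>2" for x
    using power_mono[OF psd_norm_le[OF q(2), of x] norm_ge_zero, of 2] q(1) by (simp add: power_mult_distrib)
  have "(\<integral>\<^sup>+x. ennreal ((norm x)\<^sup>2) \<partial>(gaussian 0 A)) = (\<integral>\<^sup>+x. ennreal ((norm (?S *v x))\<^sup>2) \<partial>?G)"
    unfolding gaussian_eq_distr_standard[OF assms] by (subst nn_integral_distr) auto
  also have "\<dots> \<le> (\<integral>\<^sup>+x. ennreal (q\<^sup>2) * ennreal ((norm x)\<^sup>2) \<partial>?G)"
    using bound by (intro nn_integral_mono) (simp flip: ennreal_mult')
  also have "\<dots> = ennreal (q\<^sup>2) * (\<integral>\<^sup>+x. ennreal ((norm x)\<^sup>2) \<partial>?G)"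
    by (rule nn_integral_cmult) measurable
  also have "\<dots> < \<infinity>" using standard_gaussian_second_moment[where 'n='n] by (simp add: ennreal_mult_less_top)
  finally have "(\<integral>\<^sup>+x. ennreal ((norm x)\<^sup>2) \<partial>(gaussian 0 A)) < \<infinity>" .
  moreover have "prob_space (gaussian 0 A)"
    unfolding gaussian_eq_distr_standard[OF assms] by (rule G.prob_space_distr) measurable
  ultimately show ?thesis by (simp add: P2_def)
qed

section \<open>Quadratic transport cost and quadratic dual potentials\<close>

lemma P2D:
  assumes "\<mu> \<in> P2"
  shows "sets \<mu> = sets borel" "prob_space \<mu>" "integrable \<mu> (\<lambda>x. (norm x)\<^sup>2)"
proof -
  show s: "sets \<mu> = sets borel" "prob_space \<mu>" using assms by (auto simp: P2_def)
  have "(\<lambda>x. (norm x)\<^sup>2) \<in> borel_measurable \<mu>"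
    unfolding measurable_cong_sets[OF s(1) refl] by measurable
  then show "integrable \<mu> (\<lambda>x. (norm x)\<^sup>2)"
    using assms by (intro integrableI_bounded) (auto simp: P2_def)
qed

lemma integrable_quadratic_form:
  fixes \<mu> :: "(real^'n) measure"
  assumes "\<mu> \<in> P2"
  shows "integrable \<mu> (\<lambda>x. x \<bullet> (M *v x))"
proof (rule Bochner_Integration.integrable_bound)
  show "integrable \<mu> (\<lambda>x. onorm ((*v) M) * (norm x)\<^sup>2)"
    using P2D(3)[OF assms] by simp
  show "(\<lambda>x. x \<bullet> (M *v x)) \<in> borel_measurable \<mu>"
    unfolding measurable_cong_sets[OF P2D(1)[OF assms] refl] by measurable
  have "norm (x \<bullet> (M *v x)) \<le> norm (onorm ((*v) M) * (norm x)\<^sup>2)" for x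
  proof -
    have "norm (x \<bullet> (M *v x)) \<le> norm x * norm (M *v x)" by (simp add: Cauchy_Schwarz_ineq2)
    also have "\<dots> \<le> norm x * (onorm ((*v) M) * norm x)"
      by (intro mult_left_mono onorm) auto
    also have "\<dots> = onorm ((*v) M) * (norm x)\<^sup>2" by (simp add: power2_eq_square)
    finally show ?thesis by simp
  qed
  then show "AE x in \<mu>. norm (x \<bullet> (M *v x)) \<le> norm (onorm ((*v) M) * (norm x)\<^sup>2)" by simp
qed

lemma integrable_identity_minus_quadratic_form:
  fixes \<mu> :: "(real^'n) measure"
  assumes "\<mu> \<in> P2"
  shows "integrable \<mu> (\<lambda>x. x \<bullet> x - x \<bullet> (M *v x))"
  using integrable_quadratic_form[OF assms, of "mat 1"] integrable_quadratic_form[OF assms, of M] by simp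

text \<open>
  The difference of the two sides is \<open>w \<bullet> T w\<close> for \<open>w = x - T\<^sup>-\<^sup>1 y\<close>. It vanishes exactly on
  the graph \<open>y = T x\<close>.
\<close>
lemma spd_young:
  fixes T :: "real^'n^'n"
  assumes "spd T"
  shows "2 * (x \<bullet> y) \<le> x \<bullet> (T *v x) + y \<bullet> (matrix_inv T *v y)"
proof -
  let ?w = "matrix_inv T *v y"
  have sym: "transpose T = T" and pos: "0 \<le> z \<bullet> (T *v z)" for z
    using assms by (auto simp: spd_def) (metis inner_zero_left less_eq_real_def)
  have "det T \<noteq> 0" using spd_det_pos[OF assms] by simp
  then have Tw: "T *v ?w = y" by (simp add: matrix_vector_mul_assoc matrix_inv_right)
  have "0 \<le> (x - ?w) \<bullet> (T *v (x - ?w))" by (rule pos)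
  also have "\<dots> = x \<bullet> (T *v x) - 2 * (x \<bullet> y) + y \<bullet> ?w"
    using symmetric_matrix_inner[OF sym, of ?w x] Tw
    by (simp add: matrix_vector_mult_diff_distrib inner_diff_left inner_diff_right inner_commute)
  finally show ?thesis by simp
qed

text \<open>
  The objective of the Kantorovich dual problem for the cost \<open>|x - y|\<^sup>2\<close>. For positive definite
  \<open>T\<close> the two integrands are admissible potentials: their sum is at most the cost.
\<close>
definition kantorovich_dual :: "real^'n^'n \<Rightarrow> (real^'n) measure \<Rightarrow> (real^'n) measure \<Rightarrow> real" where
  "kantorovich_dual T \<mu> \<nu> =
     (\<integral>x. x \<bullet> x - x \<bullet> (T *v x) \<partial>\<mu>) + (\<integral>y. y \<bullet> y - y \<bullet> (matrix_inv T *v y) \<partial>\<nu>)"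

text \<open>
  Weak duality: the sum of the two potentials is at most the cost by Young's inequality, and the
  integral of the sum against a coupling depends on the marginals only.
\<close>
lemma W2_sq_ge_dual:
  fixes \<mu> \<nu> :: "(real^'n) measure"
  assumes \<mu>: "\<mu> \<in> P2" and \<nu>: "\<nu> \<in> P2" and T: "spd T"
  shows "ereal (kantorovich_dual T \<mu> \<nu>) \<le> enn2ereal (W2_sq \<mu> \<nu>)"
proof -
  let ?u = "\<lambda>x. x \<bullet> x - x \<bullet> (T *v x)" and ?v = "\<lambda>y. y \<bullet> y - y \<bullet> (matrix_inv T *v y)"
  have "ennreal (kantorovich_dual T \<mu> \<nu>) \<le> (\<integral>\<^sup>+z. ennreal ((norm (fst z - snd z))\<^sup>2) \<partial>\<pi>)"
    if \<pi>: "\<pi> \<in> couplings \<mu> \<nu>" for \<pi>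
  proof -
    have sets_\<pi> [measurable_cong]: "sets \<pi> = sets borel"
      and \<pi>\<mu>: "\<mu> = distr \<pi> borel fst" and \<pi>\<nu>: "\<nu> = distr \<pi> borel snd"
      using \<pi> by (auto simp: couplings_def)
    have [measurable]: "fst \<in> measurable \<pi> borel" "snd \<in> measurable \<pi> borel"
      unfolding measurable_cong_sets[OF sets_\<pi> refl]
      by (auto intro!: borel_measurable_continuous_onI continuous_intros)
    have x: "integrable \<pi> (\<lambda>z. ?u (fst z))" "(\<integral>z. ?u (fst z) \<partial>\<pi>) = (\<integral>x. ?u x \<partial>\<mu>)"
      and x2: "integrable \<pi> (\<lambda>z. (norm (fst z))\<^sup>2)"
      using integrable_identity_minus_quadratic_form[OF \<mu>, of T] P2D(3)[OF \<mu>] unfolding \<pi>\<mu>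
      by (simp_all add: integrable_distr_eq integral_distr)
    have y: "integrable \<pi> (\<lambda>z. ?v (snd z))" "(\<integral>z. ?v (snd z) \<partial>\<pi>) = (\<integral>x. ?v x \<partial>\<nu>)"
      and y2: "integrable \<pi> (\<lambda>z. (norm (snd z))\<^sup>2)"
      using integrable_identity_minus_quadratic_form[OF \<nu>, of "matrix_inv T"] P2D(3)[OF \<nu>] unfolding \<pi>\<nu>
      by (simp_all add: integrable_distr_eq integral_distr)
    have cost: "integrable \<pi> (\<lambda>z. (norm (fst z - snd z))\<^sup>2)"
    proof (rule Bochner_Integration.integrable_bound)
      show "integrable \<pi> (\<lambda>z. 2 * (norm (fst z))\<^sup>2 + 2 * (norm (snd z))\<^sup>2)" using x2 y2 by simp
      have "(norm (a - b))\<^sup>2 \<le> 2 * (norm a)\<^sup>2 + 2 * (norm b)\<^sup>2" for a b :: "real^'n"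
        using zero_le_power2[of "norm (a + b)"] unfolding power2_norm_eq_inner
        by (simp add: inner_diff_left inner_diff_right inner_add_left inner_add_right inner_commute)
      then show "AE z in \<pi>. norm ((norm (fst z - snd z))\<^sup>2) \<le> norm (2 * (norm (fst z))\<^sup>2 + 2 * (norm (snd z))\<^sup>2)"
        by simp
    qed measurable
    have "kantorovich_dual T \<mu> \<nu> = (\<integral>z. ?u (fst z) + ?v (snd z) \<partial>\<pi>)"
      unfolding kantorovich_dual_def Bochner_Integration.integral_add[OF x(1) y(1)] x(2) y(2) ..
    also have "\<dots> \<le> (\<integral>z. (norm (fst z - snd z))\<^sup>2 \<partial>\<pi>)"
    proof (rule integral_mono[OF Bochner_Integration.integrable_add[OF x(1) y(1)] cost])
      fix z :: "(real^'n) \<times> (real^'n)"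
      show "?u (fst z) + ?v (snd z) \<le> (norm (fst z - snd z))\<^sup>2"
        using spd_young[OF T, of "fst z" "snd z"] unfolding power2_norm_eq_inner
        by (simp add: inner_diff_left inner_diff_right inner_commute)
    qed
    finally have "ennreal (kantorovich_dual T \<mu> \<nu>) \<le> ennreal (\<integral>z. (norm (fst z - snd z))\<^sup>2 \<partial>\<pi>)"
      by (rule ennreal_leI)
    also have "\<dots> = (\<integral>\<^sup>+z. ennreal ((norm (fst z - snd z))\<^sup>2) \<partial>\<pi>)"
      by (rule nn_integral_eq_integral[symmetric, OF cost]) simp
    finally show ?thesis .
  qed
  then have "ennreal (kantorovich_dual T \<mu> \<nu>) \<le> W2_sq \<mu> \<nu>"
    unfolding W2_sq_def by (rule INF_greatest)
  then have "enn2ereal (ennreal (kantorovich_dual T \<mu> \<nu>)) \<le> enn2ereal (W2_sq \<mu> \<nu>)"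
    by (simp add: less_eq_ennreal.rep_eq)
  moreover have "ereal (kantorovich_dual T \<mu> \<nu>) \<le> enn2ereal (ennreal (kantorovich_dual T \<mu> \<nu>))"
    by (cases "0 \<le> kantorovich_dual T \<mu> \<nu>") (simp_all add: enn2ereal_ennreal ennreal_neg zero_ennreal.rep_eq)
  ultimately show ?thesis by (rule order_trans[rotated])
qed

text \<open>
  The coupling carried by the graph of \<open>T\<close> attains the lower bound, because Young's inequality is
  an equality on that graph.
\<close>
lemma W2_sq_linear_image:
  fixes \<mu> :: "(real^'n) measure"
  assumes \<mu>: "\<mu> \<in> P2" and T: "spd T" and \<nu>: "distr \<mu> borel ((*v) T) \<in> P2"
  shows "enn2ereal (W2_sq \<mu> (distr \<mu> borel ((*v) T))) = ereal (kantorovich_dual T \<mu> (distr \<mu> borel ((*v) T)))"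
proof (rule antisym)
  let ?\<nu> = "distr \<mu> borel ((*v) T)"
  note [measurable_cong] = P2D(1)[OF \<mu>]
  interpret prob_space \<mu> by (rule P2D(2)[OF \<mu>])
  define \<pi> where "\<pi> = distr \<mu> borel (\<lambda>x. (x, T *v x))"
  have graph [measurable]: "(\<lambda>x. (x, T *v x)) \<in> measurable \<mu> borel"
    unfolding measurable_cong_sets[OF P2D(1)[OF \<mu>] refl]
    by (intro borel_measurable_continuous_onI continuous_intros)
  have [measurable]: "fst \<in> measurable borel (borel :: (real^'n) measure)" "snd \<in> measurable borel (borel :: (real^'n) measure)"
    by (auto intro!: borel_measurable_continuous_onI continuous_intros)
  have "\<pi> \<in> couplings \<mu> ?\<nu>"
    unfolding couplings_def \<pi>_def
    by (auto simp: distr_distr comp_def prob_space_distr P2D(1)[OF \<mu>] intro!: distr_id2)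
  then have "W2_sq \<mu> ?\<nu> \<le> (\<integral>\<^sup>+z. ennreal ((norm (fst z - snd z))\<^sup>2) \<partial>\<pi>)"
    unfolding W2_sq_def by (rule INF_lower)
  also have "\<dots> = (\<integral>\<^sup>+x. ennreal ((norm (x - T *v x))\<^sup>2) \<partial>\<mu>)"
    unfolding \<pi>_def by (subst nn_integral_distr) auto
  finally have le: "W2_sq \<mu> ?\<nu> \<le> (\<integral>\<^sup>+x. ennreal ((norm (x - T *v x))\<^sup>2) \<partial>\<mu>)" .
  let ?u = "\<lambda>x. x \<bullet> x - x \<bullet> (T *v x)" and ?v = "\<lambda>y. y \<bullet> y - y \<bullet> (matrix_inv T *v y)"
  have "det T \<noteq> 0" using spd_det_pos[OF T] by simp
  then have inv: "matrix_inv T *v (T *v x) = x" for x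
    by (simp add: matrix_vector_mul_assoc matrix_inv_left)
  have u: "integrable \<mu> ?u" by (rule integrable_identity_minus_quadratic_form[OF \<mu>])
  have v: "integrable \<mu> (\<lambda>x. ?v (T *v x))" "(\<integral>x. ?v (T *v x) \<partial>\<mu>) = (\<integral>y. ?v y \<partial>?\<nu>)"
    using integrable_identity_minus_quadratic_form[OF \<nu>, of "matrix_inv T"]
    by (simp_all add: integrable_distr_eq integral_distr)
  have split: "(norm (x - T *v x))\<^sup>2 = ?u x + ?v (T *v x)" for x
    unfolding inv power2_norm_eq_inner by (simp add: inner_diff_left inner_diff_right inner_commute)
  have cost: "integrable \<mu> (\<lambda>x. (norm (x - T *v x))\<^sup>2)"
    unfolding split by (rule Bochner_Integration.integrable_add[OF u v(1)])
  have eq: "(\<integral>x. (norm (x - T *v x))\<^sup>2 \<partial>\<mu>) = kantorovich_dual T \<mu> ?\<nu>"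
    unfolding split kantorovich_dual_def Bochner_Integration.integral_add[OF u v(1)] v(2) ..
  have "(\<integral>\<^sup>+x. ennreal ((norm (x - T *v x))\<^sup>2) \<partial>\<mu>) = ennreal (kantorovich_dual T \<mu> ?\<nu>)"
    using nn_integral_eq_integral[OF cost] by (simp add: eq)
  with le have "enn2ereal (W2_sq \<mu> ?\<nu>) \<le> enn2ereal (ennreal (kantorovich_dual T \<mu> ?\<nu>))"
    by (simp add: less_eq_ennreal.rep_eq)
  moreover have "0 \<le> kantorovich_dual T \<mu> ?\<nu>" unfolding eq[symmetric] by simp
  ultimately show "enn2ereal (W2_sq \<mu> ?\<nu>) \<le> ereal (kantorovich_dual T \<mu> ?\<nu>)"
    by (simp add: enn2ereal_ennreal)
next
  show "ereal (kantorovich_dual T \<mu> (distr \<mu> borel ((*v) T))) \<le> enn2ereal (W2_sq \<mu> (distr \<mu> borel ((*v) T)))"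
    by (rule W2_sq_ge_dual[OF \<mu> \<nu> T])
qed

lemma sum_ereal_mult_le:
  fixes w l :: "'i \<Rightarrow> real" and c :: "'i \<Rightarrow> ereal"
  assumes "\<And>i. i \<in> I \<Longrightarrow> 0 \<le> w i" "\<And>i. i \<in> I \<Longrightarrow> ereal (l i) \<le> c i"
  shows "ereal (\<Sum>i\<in>I. w i * l i) \<le> (\<Sum>i\<in>I. ereal (w i) * c i)"
proof -
  have "ereal (\<Sum>i\<in>I. w i * l i) = (\<Sum>i\<in>I. ereal (w i) * ereal (l i))" by simp
  also have "\<dots> \<le> (\<Sum>i\<in>I. ereal (w i) * c i)"
    using assms by (intro sum_mono ereal_mult_left_mono) auto
  finally show ?thesis .
qed

section \<open>Entropy relative to a positive density\<close>

text \<open>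
  The negative part of \<open>h + u\<close> is dominated by that of \<open>u\<close>, so its integral is finite, while the
  positive part may have infinite integral. Integrating
  \<open>\<phi>\<^sup>+ + u\<^sup>- = h + u\<^sup>+ + \<phi>\<^sup>-\<close>, an identity between nonnegative functions, avoids a
  distinction of cases.
\<close>
lemma ereal_diff_nn_integral_parts:
  fixes \<phi> h u :: "'a \<Rightarrow> real"
  assumes h: "h \<in> borel_measurable M" "\<And>x. 0 \<le> h x" and u: "integrable M u"
    and \<phi>: "\<And>x. \<phi> x = h x + u x"
  shows "enn2ereal (\<integral>\<^sup>+x. ennreal (max 0 (\<phi> x)) \<partial>M) - enn2ereal (\<integral>\<^sup>+x. ennreal (max 0 (- \<phi> x)) \<partial>M)
    = enn2ereal (\<integral>\<^sup>+x. ennreal (h x) \<partial>M) + ereal (\<integral>x. u x \<partial>M)"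
proof -
  note [measurable] = h(1) borel_measurable_integrable[OF u]
  have [measurable]: "\<phi> \<in> borel_measurable M" unfolding \<phi>[abs_def] by measurable
  define P N H a b where "P = (\<integral>\<^sup>+x. ennreal (max 0 (\<phi> x)) \<partial>M)" and "N = (\<integral>\<^sup>+x. ennreal (max 0 (- \<phi> x)) \<partial>M)"
    and "H = (\<integral>\<^sup>+x. ennreal (h x) \<partial>M)" and "a = (\<integral>x. max 0 (u x) \<partial>M)" and "b = (\<integral>x. max 0 (- u x) \<partial>M)"
  have ua: "integrable M (\<lambda>x. max 0 (u x))" "integrable M (\<lambda>x. max 0 (- u x))" using u by auto
  have a: "(\<integral>\<^sup>+x. ennreal (max 0 (u x)) \<partial>M) = ennreal a" "0 \<le> a"
    and b: "(\<integral>\<^sup>+x. ennreal (max 0 (- u x)) \<partial>M) = ennreal b" "0 \<le> b"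
    using nn_integral_eq_integral[OF ua(1)] nn_integral_eq_integral[OF ua(2)] by (simp_all add: a_def b_def)
  have "(\<integral>x. u x \<partial>M) = (\<integral>x. max 0 (u x) - max 0 (- u x) \<partial>M)"
    by (intro Bochner_Integration.integral_cong) auto
  also have "\<dots> = a - b" unfolding a_def b_def by (rule Bochner_Integration.integral_diff[OF ua])
  finally have int: "(\<integral>x. u x \<partial>M) = a - b" .
  have "N \<le> ennreal b"
    unfolding N_def b(1)[symmetric]
  proof (intro nn_integral_mono ennreal_leI)
    show "max 0 (- \<phi> x) \<le> max 0 (- u x)" for x using h(2)[of x] \<phi>[of x] by simp
  qed
  then have N: "N < \<infinity>" using ennreal_less_top le_less_trans by (metis infinity_ennreal_def)
  \<comment> \<open>Finiteness of \<open>a\<close>, \<open>b\<close> and \<open>N\<close> allows this equation to be rearranged in the extended reals.\<close>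
  have "P + ennreal b = H + ennreal a + N"
  proof -
    have "P + ennreal b = (\<integral>\<^sup>+x. ennreal (max 0 (\<phi> x)) + ennreal (max 0 (- u x)) \<partial>M)"
      unfolding P_def b(1)[symmetric] by (rule nn_integral_add[symmetric]) measurable
    also have "\<dots> = (\<integral>\<^sup>+x. ennreal (h x) + ennreal (max 0 (u x)) + ennreal (max 0 (- \<phi> x)) \<partial>M)"
    proof (rule nn_integral_cong)
      fix x
      have "max 0 (\<phi> x) + max 0 (- u x) = h x + max 0 (u x) + max 0 (- \<phi> x)"
        using h(2)[of x] \<phi>[of x] by (auto simp: max_def)
      then show "ennreal (max 0 (\<phi> x)) + ennreal (max 0 (- u x)) =
          ennreal (h x) + ennreal (max 0 (u x)) + ennreal (max 0 (- \<phi> x))"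
        by (simp only: ennreal_plus[symmetric] max.cobounded1 add_nonneg_nonneg h(2))
    qed
    also have "\<dots> = H + ennreal a + N"
      unfolding N_def H_def a(1)[symmetric] by (simp add: nn_integral_add)
    finally show ?thesis .
  qed
  then have "enn2ereal P + ereal b = enn2ereal H + ereal a + enn2ereal N"
    using a(2) b(2) by (metis enn2ereal_ennreal plus_ennreal.rep_eq)
  moreover obtain n where "enn2ereal N = ereal n" "0 \<le> n"
    using N by (cases N) (auto simp: enn2ereal_ennreal)
  ultimately have "enn2ereal P - enn2ereal N = enn2ereal H + ereal (a - b)"
    by (cases "enn2ereal P"; cases "enn2ereal H") auto
  then show ?thesis by (simp add: P_def N_def H_def int)
qed

text \<open>
  Divided by \<open>f\<close>, this is \<open>ln t \<le> t - 1\<close> at \<open>t = g / f\<close>, where equality forces \<open>t = 1\<close>. At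
  \<open>f = 0\<close> the convention \<open>0 ln 0 = 0\<close> leaves \<open>g > 0\<close>.
\<close>
lemma klein_inequality:
  fixes f g :: real
  assumes "0 \<le> f" "0 < g"
  shows "0 \<le> f * ln f - f * ln g - f + g"
    and "f * ln f - f * ln g - f + g = 0 \<Longrightarrow> f = g"
proof -
  have "0 \<le> f * ln f - f * ln g - f + g \<and> (f * ln f - f * ln g - f + g = 0 \<longrightarrow> f = g)"
  proof (cases "f = 0")
    case False
    then have f: "f > 0" using assms by simp
    have eq: "f * ln f - f * ln g - f + g = f * (g / f - 1 - ln (g / f))"
      using f assms by (simp add: ln_div field_simps)
    have "ln (g / f) \<le> g / f - 1" using f assms by (intro ln_le_minus_one) simp
    moreover have "f = g" if "ln (g / f) = g / f - 1"
      using ln_eq_minus_one[OF _ that] f assms by simp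
    ultimately show ?thesis unfolding eq using f by auto
  qed (use assms in auto)
  then show "0 \<le> f * ln f - f * ln g - f + g" "f * ln f - f * ln g - f + g = 0 \<Longrightarrow> f = g" by auto
qed

text \<open>
  For positive \<open>g\<close> the integrand is made nonnegative pointwise by the terms \<open>g - f\<close>, which integrate to zero when
  both densities have mass one. The integral is therefore defined in the extended nonnegative reals
  even when \<open>f ln (f / g)\<close> is not integrable.
\<close>
definition relative_entropy :: "'a::euclidean_space measure \<Rightarrow> ('a \<Rightarrow> real) \<Rightarrow> ennreal" where
  "relative_entropy \<mu> g = (\<integral>\<^sup>+x. ennreal (let f = enn2real (RN_deriv lborel \<mu> x) in
      f * ln f - f * ln (g x) - f + g x) \<partial>lborel)"

lemma lborel_density_enn2real_RN_deriv:
  fixes \<mu> :: "'a::euclidean_space measure"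
  assumes "prob_space \<mu>" "sets \<mu> = sets borel" "absolutely_continuous lborel \<mu>"
  shows "\<mu> = density lborel (\<lambda>x. ennreal (enn2real (RN_deriv lborel \<mu> x)))"
proof -
  interpret prob_space \<mu> by fact
  have "AE x in lborel. RN_deriv lborel \<mu> x \<noteq> \<infinity>"
    using assms by (intro sigma_finite_measure.RN_deriv_finite[OF sigma_finite_lborel]) (auto intro: sigma_finite_measure_axioms)
  then have "AE x in lborel. RN_deriv lborel \<mu> x = ennreal (enn2real (RN_deriv lborel \<mu> x))"
    by eventually_elim (simp add: less_top)
  then have "density lborel (RN_deriv lborel \<mu>) = density lborel (\<lambda>x. ennreal (enn2real (RN_deriv lborel \<mu> x)))"
    by (intro density_cong) auto
  then show ?thesis using sigma_finite_measure.density_RN_deriv[OF sigma_finite_lborel assms(3)] assms(2) by simp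
qed

text \<open>
  Pointwise, \<open>f ln f\<close> is the nonnegative integrand of the relative entropy plus
  \<open>f ln g + f - g\<close>. The latter is integrable, with integral equal to that of \<open>ln g\<close> against \<open>\<mu>\<close>.
\<close>
theorem neg_entropy_eq_relative_entropy:
  fixes \<mu> :: "'a::euclidean_space measure" and g :: "'a \<Rightarrow> real"
  assumes \<mu>: "prob_space \<mu>" "sets \<mu> = sets borel" "absolutely_continuous lborel \<mu>"
    and g: "g \<in> borel_measurable borel" "\<And>x. 0 < g x" "(\<integral>\<^sup>+x. ennreal (g x) \<partial>lborel) = 1"
    and ln_g: "integrable \<mu> (\<lambda>x. ln (g x))"
  shows "neg_entropy \<mu> = enn2ereal (relative_entropy \<mu> g) + ereal (\<integral>x. ln (g x) \<partial>\<mu>)"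
proof -
  interpret prob_space \<mu> by fact
  note [measurable] = g(1)
  define f where "f x = enn2real (RN_deriv lborel \<mu> x)" for x
  have f [measurable]: "f \<in> borel_measurable borel" unfolding f_def by measurable
  have f0: "0 \<le> f x" for x by (simp add: f_def)
  have dens: "\<mu> = density lborel (\<lambda>x. ennreal (f x))"
    unfolding f_def by (rule lborel_density_enn2real_RN_deriv[OF \<mu>])
  have "emeasure (density lborel (\<lambda>x. ennreal (f x))) UNIV = 1"
    using emeasure_space_1 sets_eq_imp_space_eq[OF \<mu>(2)] by (simp flip: dens)
  then have "(\<integral>\<^sup>+x. ennreal (f x) \<partial>lborel) = 1"
    by (simp add: emeasure_density)
  then have f1: "has_bochner_integral lborel f 1"
    by (intro has_bochner_integral_nn_integral) (auto simp: f0)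
  have g1: "has_bochner_integral lborel g 1"
    using g by (intro has_bochner_integral_nn_integral) (auto intro: less_imp_le)
  have fl: "integrable lborel (\<lambda>x. f x * ln (g x))" "(\<integral>x. f x * ln (g x) \<partial>lborel) = (\<integral>x. ln (g x) \<partial>\<mu>)"
  proof -
    show "integrable lborel (\<lambda>x. f x * ln (g x))"
      using ln_g by (subst (asm) dens) (simp add: integrable_density f0)
    show "(\<integral>x. f x * ln (g x) \<partial>lborel) = (\<integral>x. ln (g x) \<partial>\<mu>)"
      by (subst dens) (simp add: integral_density f0)
  qed
  define u where "u x = f x * ln (g x) + (f x - g x)" for x
  have u: "integrable lborel u" "(\<integral>x. u x \<partial>lborel) = (\<integral>x. ln (g x) \<partial>\<mu>)"
    unfolding u_def using f1 g1 fl by (auto simp: has_bochner_integral_iff)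
  define h where "h x = f x * ln (f x) - f x * ln (g x) - f x + g x" for x
  have [measurable]: "h \<in> borel_measurable borel" unfolding h_def by measurable
  have "neg_entropy \<mu> = enn2ereal (\<integral>\<^sup>+x. ennreal (max 0 (f x * ln (f x))) \<partial>lborel)
      - enn2ereal (\<integral>\<^sup>+x. ennreal (max 0 (- (f x * ln (f x)))) \<partial>lborel)"
    using \<mu>(3) by (simp add: neg_entropy_def f_def)
  also have "\<dots> = enn2ereal (\<integral>\<^sup>+x. ennreal (h x) \<partial>lborel) + ereal (\<integral>x. u x \<partial>lborel)"
  proof (rule ereal_diff_nn_integral_parts)
    show "0 \<le> h x" for x unfolding h_def by (rule klein_inequality(1)[OF f0 g(2)])
    show "f x * ln (f x) = h x + u x" for x by (simp add: h_def u_def)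
  qed (use u(1) in simp_all)
  also have "(\<integral>\<^sup>+x. ennreal (h x) \<partial>lborel) = relative_entropy \<mu> g"
    by (simp add: relative_entropy_def h_def f_def Let_def)
  finally show ?thesis by (simp add: u(2))
qed

lemma relative_entropy_eq_0_iff:
  fixes \<mu> :: "'a::euclidean_space measure" and g :: "'a \<Rightarrow> real"
  assumes \<mu>: "prob_space \<mu>" "sets \<mu> = sets borel" "absolutely_continuous lborel \<mu>"
    and g: "g \<in> borel_measurable borel" "\<And>x. 0 < g x"
  shows "relative_entropy \<mu> g = 0 \<longleftrightarrow> \<mu> = density lborel (\<lambda>x. ennreal (g x))"
proof -
  note [measurable] = g(1)
  define f where "f x = enn2real (RN_deriv lborel \<mu> x)" for x
  have [measurable]: "f \<in> borel_measurable borel" unfolding f_def by measurable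
  have dens: "\<mu> = density lborel (\<lambda>x. ennreal (f x))"
    unfolding f_def by (rule lborel_density_enn2real_RN_deriv[OF \<mu>])
  have f0: "0 \<le> f x" for x by (simp add: f_def)
  have "relative_entropy \<mu> g = (\<integral>\<^sup>+x. ennreal (f x * ln (f x) - f x * ln (g x) - f x + g x) \<partial>lborel)"
    by (simp add: relative_entropy_def f_def Let_def)
  also have "\<dots> = 0 \<longleftrightarrow> (AE x in lborel. ennreal (f x * ln (f x) - f x * ln (g x) - f x + g x) = 0)"
    by (rule nn_integral_0_iff_AE) measurable
  also have "\<dots> \<longleftrightarrow> (AE x in lborel. ennreal (f x) = ennreal (g x))"
  proof (intro AE_cong)
    fix x
    have "f x * ln (f x) - f x * ln (g x) - f x + g x = 0 \<longleftrightarrow> f x = g x"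
      using klein_inequality(2)[OF f0 g(2)] by auto
    then show "ennreal (f x * ln (f x) - f x * ln (g x) - f x + g x) = 0 \<longleftrightarrow> ennreal (f x) = ennreal (g x)"
      using klein_inequality(1)[OF f0 g(2), of x x] f0[of x] g(2)[of x] by (simp add: ennreal_eq_0_iff)
  qed
  also have "\<dots> \<longleftrightarrow> density lborel (\<lambda>x. ennreal (f x)) = density lborel (\<lambda>x. ennreal (g x))"
    by (rule sigma_finite_measure.density_unique_iff[OF sigma_finite_lborel, symmetric]) measurable
  finally show ?thesis using dens by simp
qed

lemma nn_integral_gauss_density:
  assumes "spd A"
  shows "(\<integral>\<^sup>+x. ennreal (gauss_density A x) \<partial>lborel) = 1"
proof -
  interpret prob_space "gaussian 0 A" by (rule P2D(2)[OF gaussian_in_P2[OF assms]])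
  show ?thesis using emeasure_space_1 by (simp add: gaussian_eq_density emeasure_density)
qed

text \<open>
  The log-density of a Gaussian is a quadratic form plus a constant, hence integrable against
  every measure of finite second moment.
\<close>
lemma neg_entropy_gauss:
  fixes X :: "real^'n^'n" and \<mu> :: "(real^'n) measure"
  assumes X: "spd X" and \<mu>: "\<mu> \<in> P2" and ac: "absolutely_continuous lborel \<mu>"
  shows "neg_entropy \<mu> = enn2ereal (relative_entropy \<mu> (gauss_density X)) +
    ereal (- (\<integral>x. x \<bullet> (matrix_inv X *v x) \<partial>\<mu>) / 2 - ln (sqrt ((2 * pi) ^ CARD('n) * det X)))"
proof -
  interpret prob_space \<mu> by (rule P2D(2)[OF \<mu>])
  have d: "det X > 0" by (rule spd_det_pos[OF X])
  note q = integrable_quadratic_form[OF \<mu>, of "matrix_inv X"]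
  have "(\<integral>x. ln (gauss_density X x) \<partial>\<mu>) =
      - (\<integral>x. x \<bullet> (matrix_inv X *v x) \<partial>\<mu>) / 2 - ln (sqrt ((2 * pi) ^ CARD('n) * det X))"
    unfolding ln_gauss_density[OF d] using q by (simp add: prob_space)
  moreover have "neg_entropy \<mu> = enn2ereal (relative_entropy \<mu> (gauss_density X)) + ereal (\<integral>x. ln (gauss_density X x) \<partial>\<mu>)"
  proof (rule neg_entropy_eq_relative_entropy)
    show "integrable \<mu> (\<lambda>x. ln (gauss_density X x))"
      unfolding ln_gauss_density[OF d] using q by simp
  qed (use P2D[OF \<mu>] ac d nn_integral_gauss_density[OF X] gauss_density_pos in auto)
  ultimately show ?thesis by simp
qed

section \<open>Gaussian barycenters with entropic penalty\<close>

theorem theorem3p1: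
  fixes n :: nat and lam :: "nat \<Rightarrow> real" and \<gamma> :: real
    and A :: "nat \<Rightarrow> real^'d^'d"
  assumes "n \<ge> 1"
    and "\<And>i. i \<in> {1..n} \<Longrightarrow> lam i \<ge> 0"
    and "(\<Sum>i=1..n. lam i) = 1"
    and "\<gamma> > 0"
    and "\<And>i. i \<in> {1..n} \<Longrightarrow> spd (A i)"
  shows "\<exists>X :: real^'d^'d. spd X \<and>
    (\<forall>\<mu>. is_arg_min
           (\<lambda>\<mu>. (\<Sum>i=1..n. ereal (1/2 * lam i) * enn2ereal (W2_sq \<mu> (gaussian 0 (A i))))
                + ereal \<gamma> * neg_entropy \<mu>)
           (\<lambda>\<mu>. \<mu> \<in> P2) \<mu>
         \<longleftrightarrow> \<mu> = gaussian 0 X) \<and>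
    X - \<gamma> *\<^sub>R mat 1 =
      (\<Sum>i=1..n. lam i *\<^sub>R spd_sqrt (spd_sqrt X ** A i ** spd_sqrt X)) \<and>
    (CARD('d) = 1 \<longrightarrow> (\<forall>k.
      X $ k $ k =
        ((\<Sum>i=1..n. lam i * sqrt (A i $ k $ k))
          + sqrt ((\<Sum>i=1..n. lam i * sqrt (A i $ k $ k))\<^sup>2 + 4 * \<gamma>))\<^sup>2 / 4))"
proof -
  note lam = assms(2,3) and \<gamma> = assms(4) and A = assms(5)
  obtain X where X: "spd X"
    and eq: "X - \<gamma> *\<^sub>R mat 1 = (\<Sum>i=1..n. lam i *\<^sub>R spd_sqrt (spd_sqrt X ** A i ** spd_sqrt X))"
    using covariance_equation_solvable[of "{1..n}" lam \<gamma> A] lam \<gamma> A by blast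
  have "\<forall>i\<in>{1..n}. \<exists>T. spd T \<and> T ** X ** T = A i \<and>
      spd_sqrt X ** T ** spd_sqrt X = spd_sqrt (spd_sqrt X ** A i ** spd_sqrt X)"
    using optimal_map_exists[OF X] A by blast
  then obtain T where T: "\<And>i. i \<in> {1..n} \<Longrightarrow> spd (T i)" "\<And>i. i \<in> {1..n} \<Longrightarrow> T i ** X ** T i = A i"
    and ST: "\<And>i. i \<in> {1..n} \<Longrightarrow> spd_sqrt X ** T i ** spd_sqrt X = spd_sqrt (spd_sqrt X ** A i ** spd_sqrt X)"
    by metis
  have eqT: "X - \<gamma> *\<^sub>R mat 1 = (\<Sum>i=1..n. lam i *\<^sub>R (spd_sqrt X ** T i ** spd_sqrt X))"
    unfolding eq by (intro sum.cong) (simp_all add: ST)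
  define J where "J \<mu> = (\<Sum>i=1..n. ereal (1/2 * lam i) * enn2ereal (W2_sq \<mu> (gaussian 0 (A i))))
                + ereal \<gamma> * neg_entropy \<mu>" for \<mu> :: "(real^'d) measure"
  define g where "g = gauss_density X"
  define c where "c = ln (sqrt ((2 * pi) ^ CARD('d) * det X))"
  define C where "C i = (\<integral>y. y \<bullet> y - y \<bullet> (matrix_inv (T i) *v y) \<partial>gaussian 0 (A i))" for i
  define K where "K = (\<Sum>i=1..n. lam i * C i) / 2 - \<gamma> * c"
  have GX: "gaussian 0 X \<in> P2" by (rule gaussian_in_P2[OF X])
  have detX: "det X > 0" by (rule spd_det_pos[OF X])
  have GX_dens: "gaussian 0 X = density lborel (\<lambda>x. ennreal (g x))"
    by (simp add: gaussian_eq_density g_def)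
  have g: "g \<in> borel_measurable borel" "\<And>x. 0 < g x"
    by (simp_all add: g_def gauss_density_pos[OF detX])
  have dual: "(\<Sum>i=1..n. (1/2 * lam i) * kantorovich_dual (T i) \<mu> (gaussian 0 (A i))) =
      K + \<gamma> * ((\<integral>x. x \<bullet> (matrix_inv X *v x) \<partial>\<mu>) / 2 + c)" if \<mu>: "\<mu> \<in> P2" for \<mu>
  proof -
    note int = integrable_quadratic_form[OF \<mu>]
    have sq: "integrable \<mu> (\<lambda>x. x \<bullet> x)" using int[of "mat 1"] by simp
    have "(\<Sum>i=1..n. lam i * (\<integral>x. x \<bullet> x - x \<bullet> (T i *v x) \<partial>\<mu>)) =
        (\<integral>x. (\<Sum>i=1..n. lam i * (x \<bullet> x - x \<bullet> (T i *v x))) \<partial>\<mu>)"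
      using int sq by (subst Bochner_Integration.integral_sum) auto
    also have "\<dots> = (\<integral>x. \<gamma> * (x \<bullet> (matrix_inv X *v x)) \<partial>\<mu>)"
    proof (rule Bochner_Integration.integral_cong[OF refl])
      fix x
      have "(\<Sum>i=1..n. lam i * (x \<bullet> x - x \<bullet> (T i *v x))) = (\<Sum>i=1..n. lam i) * (x \<bullet> x) - (\<Sum>i=1..n. lam i * (x \<bullet> (T i *v x)))"
        by (simp add: right_diff_distrib sum_subtractf sum_distrib_right)
      then show "(\<Sum>i=1..n. lam i * (x \<bullet> x - x \<bullet> (T i *v x))) = \<gamma> * (x \<bullet> (matrix_inv X *v x))"
        using sum_optimal_maps[OF X eqT, of x] lam(2) by simp
    qed
    finally have *: "(\<Sum>i=1..n. lam i * (\<integral>x. x \<bullet> x - x \<bullet> (T i *v x) \<partial>\<mu>)) = \<gamma> * (\<integral>x. x \<bullet> (matrix_inv X *v x) \<partial>\<mu>)"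
      by simp
    have "(\<Sum>i=1..n. (1/2 * lam i) * kantorovich_dual (T i) \<mu> (gaussian 0 (A i))) =
        ((\<Sum>i=1..n. lam i * (\<integral>x. x \<bullet> x - x \<bullet> (T i *v x) \<partial>\<mu>)) + (\<Sum>i=1..n. lam i * C i)) / 2"
      by (simp add: kantorovich_dual_def C_def distrib_left sum.distrib sum_divide_distrib add_divide_distrib)
    then show ?thesis unfolding * K_def by (simp add: field_simps)
  qed
  \<comment> \<open>The integrals against \<open>\<mu>\<close> add up to \<open>-\<gamma>\<close> times that of the log-density of \<open>\<N>(0, X)\<close>, and \<open>K\<close> collects the constants.\<close>
  have transport_ge: "ereal (K + \<gamma> * ((\<integral>x. x \<bullet> (matrix_inv X *v x) \<partial>\<mu>) / 2 + c)) \<le>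
      (\<Sum>i=1..n. ereal (1/2 * lam i) * enn2ereal (W2_sq \<mu> (gaussian 0 (A i))))" if \<mu>: "\<mu> \<in> P2" for \<mu>
    unfolding dual[OF \<mu>, symmetric]
    by (rule sum_ereal_mult_le) (use lam(1) T(1) A \<mu> in \<open>auto intro!: W2_sq_ge_dual gaussian_in_P2\<close>)
  have transport_eq: "(\<Sum>i=1..n. ereal (1/2 * lam i) * enn2ereal (W2_sq (gaussian 0 X) (gaussian 0 (A i)))) =
      ereal (K + \<gamma> * ((\<integral>x. x \<bullet> (matrix_inv X *v x) \<partial>gaussian 0 X) / 2 + c))"
  proof -
    have "enn2ereal (W2_sq (gaussian 0 X) (gaussian 0 (A i))) =
        ereal (kantorovich_dual (T i) (gaussian 0 X) (gaussian 0 (A i)))" if i: "i \<in> {1..n}" for i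
    proof -
      have "det (T i) \<noteq> 0" using spd_det_pos[OF T(1)[OF i]] by simp
      then have "distr (gaussian 0 X) borel ((*v) (T i)) = gaussian 0 (A i)"
        using distr_gaussian_linear[OF detX, of "T i"] T[OF i] by (simp add: spd_def)
      then show ?thesis
        using W2_sq_linear_image[OF GX T(1)[OF i]] gaussian_in_P2[OF A[OF i]] by simp
    qed
    then show ?thesis unfolding dual[OF GX, symmetric] by simp
  qed
  have entropy: "ereal \<gamma> * neg_entropy \<mu> = ereal \<gamma> * enn2ereal (relative_entropy \<mu> g) -
      ereal (\<gamma> * ((\<integral>x. x \<bullet> (matrix_inv X *v x) \<partial>\<mu>) / 2 + c))"
    if \<mu>: "\<mu> \<in> P2" and ac: "absolutely_continuous lborel \<mu>" for \<mu>
    unfolding neg_entropy_gauss[OF X \<mu> ac] g_def[symmetric] c_def[symmetric]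
    using \<gamma> by (cases "enn2ereal (relative_entropy \<mu> g)") (auto simp: field_simps)
  have ac_X: "absolutely_continuous lborel (gaussian 0 X)"
    unfolding GX_dens by (rule absolutely_continuousI_density) (use g(1) in simp)
  have rel_0: "relative_entropy \<mu> g = 0 \<longleftrightarrow> \<mu> = gaussian 0 X"
    if "\<mu> \<in> P2" "absolutely_continuous lborel \<mu>" for \<mu>
    unfolding GX_dens using P2D[OF that(1)] that(2) g by (intro relative_entropy_eq_0_iff)
  have J_X: "J (gaussian 0 X) = ereal K"
    unfolding J_def transport_eq entropy[OF GX ac_X] using rel_0[OF GX ac_X]
    by (simp add: zero_ennreal.rep_eq)
  \<comment> \<open>Only a vanishing relative entropy could give the value \<open>K\<close>; without a density the value is infinite.\<close>
  have J_gt: "ereal K < J \<mu>" if \<mu>: "\<mu> \<in> P2" "\<mu> \<noteq> gaussian 0 X" for \<mu>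
  proof (cases "absolutely_continuous lborel \<mu>")
    case True
    have "0 < relative_entropy \<mu> g"
      using rel_0[OF \<mu>(1) True] \<mu>(2) by (simp add: zero_less_iff_neq_zero)
    then have "0 < enn2ereal (relative_entropy \<mu> g)"
      by (simp add: less_ennreal.rep_eq zero_ennreal.rep_eq)
    then have "0 < ereal \<gamma> * enn2ereal (relative_entropy \<mu> g)"
      using \<gamma> by (cases "enn2ereal (relative_entropy \<mu> g)") auto
    moreover have "ereal K < S + (Q - ereal q)" if "0 < Q" "ereal (K + q) \<le> S" for Q S :: ereal and q :: real
      using that by (cases Q; cases S) auto
    ultimately show ?thesis
      unfolding J_def entropy[OF \<mu>(1) True] using transport_ge[OF \<mu>(1)] by blast
  next
    case False
    then have "ereal \<gamma> * neg_entropy \<mu> = \<infinity>" using \<gamma> by (simp add: neg_entropy_def)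
    moreover have "(\<Sum>i=1..n. ereal (1/2 * lam i) * enn2ereal (W2_sq \<mu> (gaussian 0 (A i)))) \<noteq> -\<infinity>"
      using transport_ge[OF \<mu>(1)] by auto
    moreover have "ereal K < S + Q" if "Q = \<infinity>" "S \<noteq> -\<infinity>" for Q S :: ereal
      using that by (cases S) auto
    ultimately show ?thesis unfolding J_def by blast
  qed
  have "is_arg_min J (\<lambda>\<mu>. \<mu> \<in> P2) \<mu> \<longleftrightarrow> \<mu> = gaussian 0 X" for \<mu>
    unfolding is_arg_min_def using J_gt J_X GX by (metis less_asym less_irrefl)
  then have "\<forall>\<mu>. is_arg_min
           (\<lambda>\<mu>. (\<Sum>i=1..n. ereal (1/2 * lam i) * enn2ereal (W2_sq \<mu> (gaussian 0 (A i))))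
                + ereal \<gamma> * neg_entropy \<mu>)
           (\<lambda>\<mu>. \<mu> \<in> P2) \<mu> \<longleftrightarrow> \<mu> = gaussian 0 X"
    unfolding J_def[abs_def] by blast
  then show ?thesis
    using X eq scalar_covariance[OF _ X A \<gamma> lam(1) eq] by blast
qed

end
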